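(* Let $K$ be a commutative ring with identity and let $q$ be an invertible element of $K$. The tower of affine Hecke algebras $$H\tilde A_1(q)\xrightarrow{HR_2}H\tilde A_2(q)\xrightarrow{HR_3}\cdots\longrightarrow H\tilde A_{n-1}(q)\xrightarrow{HR_n}H\tilde A_n(q)\longrightarrow\cdots$$ is a tower of faithful arrows, i.e. for every $n\ge2$ the algebra morphism $HR_n:H\tilde A_{n-1}(q)\to H\tilde A_n(q)$ is injective.
   Context: For $n\ge2$, $W(\tilde A_n)$ is the Coxeter group with generating set $S_n=\{\sigma_1,\dots,\sigma_n,a_{n+1}\}$ whose Coxeter graph is the cycle $\sigma_1-\sigma_2-\cdots-\sigma_n-a_{n+1}-\sigma_1$ (all edges of label 3); $W(\tilde A_1)$ is the infinite dihedral group generated by the two simple reflections $S_1=\{\sigma_1,a_2\}$ (no braid relation). For $w\in W(\tilde A_n)$, $\mathscr L(w)=\{s\in S_n: l(sw)<l(w)\}$. $H\tilde A_n(q)$ is the free $K$-module with basis $\{g_w: w\in W(\tilde A_n)\}$ with the unique $K$-algebra structure satisfying, for $s\in S_n$ and $w\in W(\tilde A_n)$: $g_sg_w=g_{sw}$ if $s\notin\mathscr L(w)$, and $g_sg_w=q\,g_{sw}+(q-1)g_w$ if $s\in\mathscr L(w)$. The elements $g_s$, $s\in S_n$, are invertible. Writing $e_w$ for the basis elements of $H\tilde A_{n-1}(q)$ and $g_w$ for those of $H\tilde A_n(q)$, $HR_n:H\tilde A_{n-1}(q)\to H\tilde A_n(q)$ is the morphism of $K$-algebras with $HR_n(e_{\sigma_i})=g_{\sigma_i}$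 for $1\le i\le n-1$ and $HR_n(e_{a_n})=g_{\sigma_n}g_{a_{n+1}}g_{\sigma_n}^{-1}$. *)

theory Defs
  imports "HOL-Algebra.Ring" "HOL-Algebra.Module" "HOL-Library.Poly_Mapping"
begin

section \<open>Coxeter groups\<close>

text \<open>
  The Coxeter group with generators \<open>S\<close> and Coxeter matrix \<open>m\<close> is presented by
  \<open>(s t)^(m s t) = 1\<close>, where \<open>m s t = 0\<close> encodes the value infinity (no relation).
  Because \<open>m s s = 1\<close> gives \<open>s s = 1\<close>, every generator is its own inverse, so words
  in the generators without formal inverses suffice and the presented monoid is the
  presented group. Group elements are equivalence classes of words.
\<close>

inductive cox_eq :: "'s set \<Rightarrow> ('s \<Rightarrow> 's \<Rightarrow> nat) \<Rightarrow> 's list \<Rightarrow> 's list \<Rightarrow> bool"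
  for S :: "'s set" and m :: "'s \<Rightarrow> 's \<Rightarrow> nat"
where
  cox_rel: "\<lbrakk>xs \<in> lists S; ys \<in> lists S; s \<in> S; t \<in> S\<rbrakk>
    \<Longrightarrow> cox_eq S m (xs @ concat (replicate (m s t) [s, t]) @ ys) (xs @ ys)"
| cox_refl: "xs \<in> lists S \<Longrightarrow> cox_eq S m xs xs"
| cox_sym: "cox_eq S m xs ys \<Longrightarrow> cox_eq S m ys xs"
| cox_trans: "\<lbrakk>cox_eq S m xs ys; cox_eq S m ys zs\<rbrakk> \<Longrightarrow> cox_eq S m xs zs"

definition cox_class :: "'s set \<Rightarrow> ('s \<Rightarrow> 's \<Rightarrow> nat) \<Rightarrow> 's list \<Rightarrow> 's list set" where
  "cox_class S m xs = {ys. cox_eq S m xs ys}"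

definition coxeter_group :: "'s set \<Rightarrow> ('s \<Rightarrow> 's \<Rightarrow> nat) \<Rightarrow> 's list set monoid" where
  "coxeter_group S m =
     \<lparr>carrier = cox_class S m ` lists S,
      mult = (\<lambda>u v. \<Union>xs\<in>u. \<Union>ys\<in>v. cox_class S m (xs @ ys)),
      one = cox_class S m []\<rparr>"

text \<open>An element is the set of all words expressing it.\<close>

definition cox_length :: "'s list set \<Rightarrow> nat" where
  "cox_length w = (LEAST k. \<exists>xs\<in>w. length xs = k)"


section \<open>The affine groups of type A\<close>

text \<open>
  In type \<open>A~_n\<close> the index \<open>i \<in> {1..n}\<close> stands for \<open>\<sigma>_i\<close> and the index \<open>n + 1\<close> for
  \<open>a_{n+1}\<close>; the diagram is the cycle \<open>1 - 2 - ... - (n+1) - 1\<close>, except for \<open>n = 1\<close>,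
  where the two generators satisfy no braid relation.
\<close>

definition affA_index :: "nat \<Rightarrow> nat set" where
  "affA_index n = {1..n + 1}"

definition affA_matrix :: "nat \<Rightarrow> nat \<Rightarrow> nat \<Rightarrow> nat" where
  "affA_matrix n i j =
     (if i = j then 1
      else if n = 1 then 0
      else if j = i + 1 \<or> i = j + 1 \<or> {i, j} = {1, n + 1} then 3
      else 2)"

definition affA :: "nat \<Rightarrow> nat list set monoid" where
  "affA n = coxeter_group (affA_index n) (affA_matrix n)"

definition affA_gen :: "nat \<Rightarrow> nat \<Rightarrow> nat list set" where
  "affA_gen n i = cox_class (affA_index n) (affA_matrix n) [i]"

definition affA_gens :: "nat \<Rightarrow> nat list set set" where
  "affA_gens n = affA_gen n ` affA_index n"

definition left_descents :: "nat \<Rightarrow> nat list set \<Rightarrow> nat list set set" where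
  "left_descents n w = {s \<in> affA_gens n. cox_length (s \<otimes>\<^bsub>affA n\<^esub> w) < cox_length w}"


section \<open>Hecke algebras\<close>

text \<open>
  The sort \<open>{comm_ring, comm_monoid_mult}\<close> is that of commutative rings with identity;
  the library class \<open>comm_ring_1\<close> would in addition exclude the zero ring.

  The free module on a set \<open>W\<close> consists of the finitely supported functions supported
  in \<open>W\<close>; \<open>basis_elt w\<close> is the basis element \<open>g_w\<close> (or \<open>e_w\<close>).
\<close>

definition free_module :: "'w set \<Rightarrow> ('w \<Rightarrow>\<^sub>0 'k::zero) set" where
  "free_module W = {x. Poly_Mapping.keys x \<subseteq> W}"

definition scale :: "'k \<Rightarrow> ('w \<Rightarrow>\<^sub>0 'k) \<Rightarrow> ('w \<Rightarrow>\<^sub>0 'k::{comm_ring, comm_monoid_mult})" where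
  "scale c x = Poly_Mapping.map (\<lambda>d. c * d) x"

definition basis_elt :: "'w \<Rightarrow> ('w \<Rightarrow>\<^sub>0 'k::{comm_ring, comm_monoid_mult})" where
  "basis_elt w = Poly_Mapping.single w 1"

text \<open>
  \<open>H\<close> is a unital associative algebra over the coefficient ring whose underlying
  module is the free module on \<open>W\<close>.
\<close>

definition algebra_on_free_module ::
  "'w set \<Rightarrow> ('k::{comm_ring, comm_monoid_mult}, 'w \<Rightarrow>\<^sub>0 'k) module \<Rightarrow> bool" where
  "algebra_on_free_module W H \<longleftrightarrow>
     carrier H = free_module W \<and>
     \<zero>\<^bsub>H\<^esub> = 0 \<and>
     (\<forall>x\<in>carrier H. \<forall>y\<in>carrier H. x \<oplus>\<^bsub>H\<^esub> y = x + y) \<and>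
     (\<forall>c. \<forall>x\<in>carrier H. c \<odot>\<^bsub>H\<^esub> x = scale c x) \<and>
     ring H \<and>
     (\<forall>c. \<forall>x\<in>carrier H. \<forall>y\<in>carrier H.
        (c \<odot>\<^bsub>H\<^esub> x) \<otimes>\<^bsub>H\<^esub> y = c \<odot>\<^bsub>H\<^esub> (x \<otimes>\<^bsub>H\<^esub> y) \<and>
        x \<otimes>\<^bsub>H\<^esub> (c \<odot>\<^bsub>H\<^esub> y) = c \<odot>\<^bsub>H\<^esub> (x \<otimes>\<^bsub>H\<^esub> y))"

definition is_affine_hecke ::
  "nat \<Rightarrow> 'k::{comm_ring, comm_monoid_mult} \<Rightarrow> ('k, nat list set \<Rightarrow>\<^sub>0 'k) module \<Rightarrow> bool" where
  "is_affine_hecke n q H \<longleftrightarrow>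
     algebra_on_free_module (carrier (affA n)) H \<and>
     (\<forall>s\<in>affA_gens n. \<forall>w\<in>carrier (affA n).
        (s \<notin> left_descents n w \<longrightarrow>
           basis_elt s \<otimes>\<^bsub>H\<^esub> basis_elt w = basis_elt (s \<otimes>\<^bsub>affA n\<^esub> w)) \<and>
        (s \<in> left_descents n w \<longrightarrow>
           basis_elt s \<otimes>\<^bsub>H\<^esub> basis_elt w =
             q \<odot>\<^bsub>H\<^esub> basis_elt (s \<otimes>\<^bsub>affA n\<^esub> w) \<oplus>\<^bsub>H\<^esub> (q - 1) \<odot>\<^bsub>H\<^esub> basis_elt w))"

definition algebra_hom :: "('k, 'a) module \<Rightarrow> ('k, 'b) module \<Rightarrow> ('a \<Rightarrow> 'b) set" where
  "algebra_hom A B =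
     {f \<in> ring_hom A B. \<forall>c. \<forall>x\<in>carrier A. f (c \<odot>\<^bsub>A\<^esub> x) = c \<odot>\<^bsub>B\<^esub> f x}"

text \<open>
  \<open>E\<close> and \<open>H\<close> are the Hecke algebras of types \<open>A~_{n-1}\<close> and \<open>A~_n\<close>. In \<open>E\<close> the index \<open>n\<close>
  is that of \<open>a_n\<close>, whereas in \<open>H\<close> it is that of \<open>\<sigma>_n\<close>.
\<close>

definition is_HR ::
  "nat \<Rightarrow> ('k::{comm_ring, comm_monoid_mult}, nat list set \<Rightarrow>\<^sub>0 'k) module
     \<Rightarrow> ('k, nat list set \<Rightarrow>\<^sub>0 'k) module
     \<Rightarrow> ((nat list set \<Rightarrow>\<^sub>0 'k) \<Rightarrow> (nat list set \<Rightarrow>\<^sub>0 'k)) \<Rightarrow> bool" where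
  "is_HR n E H f \<longleftrightarrow>
     f \<in> algebra_hom E H \<and>
     (\<forall>i\<in>{1..n - 1}. f (basis_elt (affA_gen (n - 1) i)) = basis_elt (affA_gen n i)) \<and>
     f (basis_elt (affA_gen (n - 1) n)) =
       basis_elt (affA_gen n n) \<otimes>\<^bsub>H\<^esub> basis_elt (affA_gen n (n + 1))
         \<otimes>\<^bsub>H\<^esub> inv\<^bsub>H\<^esub> basis_elt (affA_gen n n)"

end

theory Submission
  imports Defs
begin

text \<open>
  Let \<open>N = n + 1\<close>. A word in the generators acts on the integers as an affine permutation of
  period \<open>N\<close>, and \<open>l(s_i w) > l(w)\<close> holds exactly when this permutation \<open>F w\<close> satisfies
  \<open>F w i < F w (i + 1)\<close>; in particular the action is faithful. The arrow covers the group
  embedding \<open>\<phi>\<close> that lets an affine permutation of period \<open>n\<close> act on the integers not divisible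
  by \<open>N\<close>. The expansion of \<open>HR(e_w)\<close> in the basis \<open>g_v\<close> is complicated, but multiplying on the
  right by \<open>g_y\<close>, where \<open>y\<close> moves the multiples of \<open>N\<close> far below all other integers, gives
  \<open>HR(e_w) g_y = g_{\<phi>(w) y}\<close> for all \<open>w\<close> of bounded length: the factor \<open>g_{\<sigma>_n}^{-1}\<close> in \<open>HR(e_{a_n})\<close>
  then always cancels a reduced first letter, and every other factor lengthens. Since
  \<open>w \<mapsto> \<phi>(w) y\<close> is injective, the coefficients of \<open>x\<close> can be read off from \<open>HR(x) g_y\<close>.
\<close>

section \<open>Words in a Coxeter group\<close>

lemma cox_eq_in_lists: "cox_eq S m xs ys \<Longrightarrow> xs \<in> lists S \<and> ys \<in> lists S"
proof (induction rule: cox_eq.induct)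
  case (cox_rel xs ys s t)
  have "concat (replicate k [s, t]) \<in> lists S" for k
    using cox_rel by (induction k) simp_all
  then show ?case using cox_rel(1,2) by (simp only: append_in_lists_conv simp_thms)
qed simp_all

lemma cox_eq_context:
  assumes "cox_eq S m xs ys" "us \<in> lists S" "vs \<in> lists S"
  shows "cox_eq S m (us @ xs @ vs) (us @ ys @ vs)"
  using assms
proof (induction rule: cox_eq.induct)
  case (cox_rel xs ys s t)
  then show ?case
    using cox_eq.cox_rel[of "us @ xs" S "ys @ vs" s t m] by simp
next
  case (cox_refl xs)
  then show ?case by (intro cox_eq.cox_refl) auto
next
  case (cox_sym xs ys)
  then show ?case by (simp add: cox_eq.cox_sym)
next
  case (cox_trans xs ys zs)
  then show ?case using cox_eq.cox_trans by simp blast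
qed

lemma cox_eq_append:
  assumes "cox_eq S m xs xs'" "cox_eq S m ys ys'"
  shows "cox_eq S m (xs @ ys) (xs' @ ys')"
proof -
  note in_lists = cox_eq_in_lists[OF assms(1)] cox_eq_in_lists[OF assms(2)]
  have "cox_eq S m (xs @ ys) (xs' @ ys)"
    using cox_eq_context[OF assms(1), of "[]" ys] in_lists by simp
  moreover have "cox_eq S m (xs' @ ys) (xs' @ ys')"
    using cox_eq_context[OF assms(2), of xs' "[]"] in_lists by simp
  ultimately show ?thesis by (rule cox_eq.cox_trans)
qed

lemma cox_eq_Cons:
  assumes "cox_eq S m xs ys" "s \<in> S"
  shows "cox_eq S m (s # xs) (s # ys)"
  using cox_eq_context[OF assms(1), of "[s]" "[]"] assms(2) by simp

lemma cox_class_eq_iff: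
  assumes "xs \<in> lists S"
  shows "cox_class S m xs = cox_class S m ys \<longleftrightarrow> cox_eq S m xs ys"
proof
  assume "cox_class S m xs = cox_class S m ys"
  moreover have "xs \<in> cox_class S m xs"
    using assms by (simp add: cox_class_def cox_eq.cox_refl)
  ultimately show "cox_eq S m xs ys"
    using cox_eq.cox_sym[of S m ys xs] by (simp add: cox_class_def)
next
  assume "cox_eq S m xs ys"
  then have "cox_eq S m xs zs \<longleftrightarrow> cox_eq S m ys zs" for zs
    using cox_eq.cox_trans[of S m xs ys zs] cox_eq.cox_trans[of S m ys xs zs] cox_eq.cox_sym[of S m xs ys]
    by blast
  then show "cox_class S m xs = cox_class S m ys"
    by (simp add: cox_class_def)
qed

lemma coxeter_group_mult:
  assumes "xs \<in> lists S" "ys \<in> lists S"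
  shows "cox_class S m xs \<otimes>\<^bsub>coxeter_group S m\<^esub> cox_class S m ys = cox_class S m (xs @ ys)"
proof -
  have eq: "cox_class S m (xs' @ ys') = cox_class S m (xs @ ys)"
    if "xs' \<in> cox_class S m xs" "ys' \<in> cox_class S m ys" for xs' ys'
  proof -
    have "cox_eq S m (xs @ ys) (xs' @ ys')"
      using that by (intro cox_eq_append) (auto simp: cox_class_def)
    then show ?thesis using assms by (subst eq_commute) (simp add: cox_class_eq_iff)
  qed
  have "xs \<in> cox_class S m xs" "ys \<in> cox_class S m ys"
    using assms by (auto simp: cox_class_def intro: cox_eq.cox_refl)
  then have "(\<Union>xs'\<in>cox_class S m xs. \<Union>ys'\<in>cox_class S m ys. cox_class S m (xs' @ ys'))
      = cox_class S m (xs @ ys)"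
    using eq by blast
  then show ?thesis by (simp add: coxeter_group_def)
qed

definition word_length :: "'s set \<Rightarrow> ('s \<Rightarrow> 's \<Rightarrow> nat) \<Rightarrow> 's list \<Rightarrow> nat" where
  "word_length S m xs = cox_length (cox_class S m xs)"

lemma word_length_le: "cox_eq S m xs ys \<Longrightarrow> word_length S m xs \<le> length ys"
  unfolding word_length_def cox_length_def by (rule Least_le) (auto simp: cox_class_def)

lemma word_length_cong: "cox_eq S m xs ys \<Longrightarrow> word_length S m xs = word_length S m ys"
  by (metis cox_class_eq_iff cox_eq_in_lists word_length_def)

lemma reduced_word_exists:
  assumes "xs \<in> lists S"
  obtains ys where "cox_eq S m xs ys" "length ys = word_length S m xs"
proof -
  have "\<exists>ys \<in> cox_class S m xs. length ys = length xs"
    using assms by (auto simp: cox_class_def intro: cox_eq.cox_refl)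
  then have "\<exists>ys \<in> cox_class S m xs. length ys = word_length S m xs"
    unfolding word_length_def cox_length_def by (rule LeastI)
  then show ?thesis using that by (auto simp: cox_class_def)
qed

lemma word_length_append_le:
  assumes "us \<in> lists S" "xs \<in> lists S"
  shows "word_length S m (us @ xs) \<le> length us + word_length S m xs"
proof -
  obtain ys where "cox_eq S m xs ys" "length ys = word_length S m xs"
    using reduced_word_exists[OF assms(2)] by blast
  then show ?thesis
    using word_length_le[OF cox_eq_append[OF cox_eq.cox_refl[OF assms(1)]]] by fastforce
qed

text \<open>A relator \<open>concat (replicate k [s, t])\<close> has length \<open>2 * k\<close>, so
  the parity of the length of a word is an invariant of its class. This is what excludes equal
  lengths of \<open>xs\<close> and \<open>s # xs\<close>.\<close>

lemma even_word_length:
  assumes "cox_eq S m xs ys"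
  shows "even (length xs) = even (length ys)"
proof -
  have [simp]: "even (length (concat (replicate k [s, t])))" for k and s t :: 'a
    by (induction k) auto
  from assms show ?thesis by (induction rule: cox_eq.induct) simp_all
qed

section \<open>Cancellation and braid moves on words, and splitting off a dihedral factor\<close>

locale coxeter_words =
  fixes S :: "'s set" and m :: "'s \<Rightarrow> 's \<Rightarrow> nat"
  assumes matrix_refl: "s \<in> S \<Longrightarrow> m s s = 1"
begin

abbreviation eq (infix "\<approx>" 50) where "eq \<equiv> cox_eq S m"
abbreviation len where "len \<equiv> word_length S m"

lemma cancel:
  assumes "s \<in> S" "us \<in> lists S" "xs \<in> lists S"
  shows "us @ s # s # xs \<approx> us @ xs"
  using cox_eq.cox_rel[of us S xs s s m] assms by (simp add: matrix_refl)

lemma cancel_Cons: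
  assumes "s \<in> S" "xs \<in> lists S"
  shows "s # s # xs \<approx> xs"
  using cancel[of s "[]" xs] assms by simp

lemma rev_cancel: "xs \<in> lists S \<Longrightarrow> rev xs @ xs \<approx> []"
proof (induction xs)
  case Nil
  then show ?case by (simp add: cox_eq.cox_refl)
next
  case (Cons x xs)
  then have "rev xs @ x # x # xs \<approx> rev xs @ xs"
    by (intro cancel) auto
  with Cons show ?case by (simp add: cox_eq.cox_trans)
qed

lemma len_Cons_neq:
  assumes "s \<in> S" "xs \<in> lists S"
  shows "len (s # xs) \<noteq> len xs"
proof -
  obtain ys where ys: "xs \<approx> ys" "length ys = len xs"
    using reduced_word_exists[OF assms(2)] .
  obtain zs where zs: "s # xs \<approx> zs" "length zs = len (s # xs)"
    using reduced_word_exists[of "s # xs" S m] assms by auto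
  have "even (length (s # ys)) = even (length zs)"
    using even_word_length[OF cox_eq_Cons[OF ys(1) assms(1)]] even_word_length[OF zs(1)] by simp
  then show ?thesis using ys(2) zs(2) by auto
qed

lemma len_le_Cons:
  assumes "s \<in> S" "xs \<in> lists S"
  shows "len xs \<le> Suc (len (s # xs))"
  using word_length_append_le[of "[s]" S "s # xs" m] word_length_cong[OF cancel_Cons[OF assms]] assms
  by simp

lemma braid2:
  assumes "s \<in> S" "t \<in> S" "m t s = 2"
  shows "[t, s] \<approx> [s, t]"
proof -
  \<comment> \<open>The relator is followed by \<open>[s, t]\<close>: deleting the relator gives one
    side, cancelling repeated letters from the inside gives the other. \<open>braid3\<close> works
    in the same way, with a relator of length six followed by \<open>[s, t, s]\<close>.\<close>
  have 1: "[t, s, t, s, s, t] \<approx> [s, t]"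
    using cox_eq.cox_rel[of "[]" S "[s, t]" t s m] assms by (simp add: numeral_2_eq_2)
  have 2: "[t, s, t, s, s, t] \<approx> [t, s, t, t]"
    using cancel[of s "[t, s, t]" "[t]"] assms by simp
  have 3: "[t, s, t, t] \<approx> [t, s]"
    using cancel[of t "[t, s]" "[]"] assms by simp
  show ?thesis
    by (rule cox_eq.cox_trans[OF cox_eq.cox_sym[OF cox_eq.cox_trans[OF 2 3]] 1])
qed

lemma braid3:
  assumes "s \<in> S" "t \<in> S" "m t s = 3"
  shows "[t, s, t] \<approx> [s, t, s]"
proof -
  have 1: "[t, s, t, s, t, s, s, t, s] \<approx> [s, t, s]"
    using cox_eq.cox_rel[of "[]" S "[s, t, s]" t s m] assms by (simp add: numeral_3_eq_3)
  have 2: "[t, s, t, s, t, s, s, t, s] \<approx> [t, s, t, s, t, t, s]"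
    using cancel[of s "[t, s, t, s, t]" "[t, s]"] assms by simp
  have 3: "[t, s, t, s, t, t, s] \<approx> [t, s, t, s, s]"
    using cancel[of t "[t, s, t, s]" "[s]"] assms by simp
  have 4: "[t, s, t, s, s] \<approx> [t, s, t]"
    using cancel[of s "[t, s, t]" "[]"] assms by simp
  show ?thesis
    by (rule cox_eq.cox_trans[OF cox_eq.cox_sym[OF cox_eq.cox_trans[OF 2 cox_eq.cox_trans[OF 3 4]]] 1])
qed

text \<open>
  The factorisation \<open>w = u v\<close> with \<open>u\<close> in the dihedral subgroup generated by \<open>s\<close> and \<open>t\<close>
  and \<open>v\<close> of minimal length in its coset.
\<close>

lemma dihedral_factorisation:
  assumes xs: "xs \<in> lists S" and s: "s \<in> S" and up: "len xs < len (s # xs)" and ne: "0 < len xs"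
  obtains t u v where "t \<in> S" "t \<noteq> s" "u \<in> lists {s, t}" "v \<in> lists S" "xs \<approx> u @ v"
    "len v < len xs" "len v < len (s # v)" "len v < len (t # v)"
    "\<And>u'. u \<approx> u' \<Longrightarrow> length u \<le> length u'"
    "\<And>u'. u \<approx> s # u' \<Longrightarrow> length u \<le> length u'"
proof -
  obtain zs where zs: "xs \<approx> zs" "length zs = len xs" using reduced_word_exists[OF xs] by blast
  with ne obtain t xs' where txs: "zs = t # xs'" by (cases zs) auto
  have t: "t \<in> S" and xs': "xs' \<in> lists S" using cox_eq_in_lists[OF zs(1)] txs by auto
  have len_xs': "len xs' \<le> length xs'"
    using xs' by (intro word_length_le cox_eq.cox_refl)
  have "len xs \<le> Suc (len xs')"
    using word_length_cong[OF zs(1)] word_length_append_le[of "[t]" S xs' m] t xs' txs by simp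
  with len_xs' zs txs have len_xs: "len xs = Suc (len xs')" by simp
  have "t \<noteq> s"
  proof
    assume "t = s"
    then have "s # xs \<approx> xs'"
      using cox_eq_Cons[OF zs(1) s] cancel_Cons[OF s xs'] txs by (metis cox_eq.cox_trans)
    then show False using word_length_cong len_xs up by fastforce
  qed
  \<comment> \<open>Only length-additive factorisations compete. For the shortest such
    \<open>v\<close>, both \<open>s\<close> and \<open>t\<close> lengthen \<open>v\<close>, since
    otherwise a letter could be moved from \<open>v\<close> to \<open>u\<close>. The tail
    \<open>xs'\<close> competes with \<open>u = [t]\<close>, which makes \<open>v\<close> shorter
    than \<open>xs\<close>.\<close>
  define P where "P v \<longleftrightarrow> (\<exists>u \<in> lists {s, t}. xs \<approx> u @ v \<and> v \<in> lists S \<and> length u + len v = len xs)" for v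
  have "P xs'" unfolding P_def using zs txs xs' len_xs by (intro bexI[of _ "[t]"]) auto
  then obtain v where v: "P v" "\<And>v'. P v' \<Longrightarrow> len v \<le> len v'"
    using ex_has_least_nat[of P] by metis
  then obtain u where u: "u \<in> lists {s, t}" "xs \<approx> u @ v" "v \<in> lists S" "length u + len v = len xs"
    unfolding P_def by blast
  have uS: "u \<in> lists S" using u(1) s t by auto
  have up_v: "len v < len (r # v)" if r: "r \<in> {s, t}" for r
  proof (rule ccontr)
    assume "\<not> ?thesis"
    moreover have rS: "r \<in> S" using r s t by auto
    ultimately have len_v: "len v = Suc (len (r # v))"
      using len_le_Cons[OF rS u(3)] len_Cons_neq[OF rS u(3)] by simp
    have "xs \<approx> (u @ [r]) @ r # v"
      using cancel[OF rS uS u(3)] u(2) by simp (metis cox_eq.cox_sym cox_eq.cox_trans)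
    then have "P (r # v)"
      unfolding P_def using u r rS len_v by (intro bexI[of _ "u @ [r]"]) auto
    then show False using v(2) len_v by fastforce
  qed
  show ?thesis
  proof (rule that[OF t \<open>t \<noteq> s\<close> u(1) u(3) u(2)])
    show "len v < len xs" using v(2)[OF \<open>P xs'\<close>] len_xs by simp
    show "len v < len (s # v)" "len v < len (t # v)" using up_v by auto
    fix u'
    { assume a: "u \<approx> u'"
      then have "xs \<approx> u' @ v"
        using cox_eq_append[OF a cox_eq.cox_refl[OF u(3)]] u(2) by (metis cox_eq.cox_trans)
      then show "length u \<le> length u'"
        using word_length_cong word_length_append_le[of u' S v m] cox_eq_in_lists[OF a] u
        by fastforce }
    \<comment> \<open>The leading \<open>s\<close> cancels in \<open>s # xs\<close>, so a short
      \<open>u'\<close> would make \<open>s # xs\<close> no longer than \<open>xs\<close>, against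
      \<open>up\<close>. Applied to the tail of \<open>u\<close>, this later shows that
      \<open>u\<close> does not begin with \<open>s\<close>.\<close>
    { assume a: "u \<approx> s # u'"
      then have u': "u' \<in> lists S" using cox_eq_in_lists[OF a] by auto
      have "s # xs \<approx> s # s # u' @ v"
        using cox_eq_append[OF a cox_eq.cox_refl[OF u(3)]] u(2) s
        by (metis append_Cons cox_eq.cox_trans cox_eq_Cons)
      then have "s # xs \<approx> u' @ v"
        using cancel_Cons[OF s, of "u' @ v"] u' u(3) by simp (metis cox_eq.cox_trans)
      then have "len (s # xs) \<le> length u' + len v"
        using word_length_cong word_length_append_le[OF u' u(3)] by fastforce
      then show "length u \<le> length u'" using up u(4) by simp }
  qed
qed

end

section \<open>Affine permutations\<close>

text \<open>For \<open>2 \<le> N\<close> this is a simple reflection of the affine symmetric group,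
  acting on the integers and commuting with translation by \<open>N\<close>. Since \<open>i\<close>
  counts only modulo \<open>N\<close>, the generator with index \<open>n + 1\<close> needs no
  separate formula: it exchanges the residues 0 and 1.\<close>

definition affine_swap :: "int \<Rightarrow> int \<Rightarrow> int \<Rightarrow> int" where
  "affine_swap N i j = (if N dvd j - i then j + 1 else if N dvd j - i - 1 then j - 1 else j)"

lemma affine_swap_left: "N dvd j - i \<Longrightarrow> affine_swap N i j = j + 1"
  by (simp add: affine_swap_def)

lemma affine_swap_right:
  assumes "2 \<le> N" "N dvd j - i"
  shows "affine_swap N i (j + 1) = j"
proof -
  have "\<not> N dvd j + 1 - i"
  proof
    assume "N dvd j + 1 - i"
    then have "N dvd (j + 1 - i) - (j - i)" using assms(2) by (rule dvd_diff)
    then show False using assms(1) by simp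
  qed
  then show ?thesis using assms by (simp add: affine_swap_def)
qed

lemma affine_swap_other: "\<not> N dvd j - i \<Longrightarrow> \<not> N dvd j - i - 1 \<Longrightarrow> affine_swap N i j = j"
  by (simp add: affine_swap_def)

lemma affine_swap_cases:
  fixes N i j :: int
  obtains "N dvd j - i" | a where "N dvd a - i" "j = a + 1" | "\<not> N dvd j - i" "\<not> N dvd j - i - 1"
  using that(1) that(2)[of "j - 1"] that(3) unfolding diff_right_commute[of j 1 i] by auto

lemma affine_swap_involution:
  assumes "2 \<le> N"
  shows "affine_swap N i (affine_swap N i j) = j"
  by (rule affine_swap_cases[of N j i])
    (simp_all add: affine_swap_left affine_swap_right[OF assms] affine_swap_other)

lemma affine_swap_shift:
  assumes "N dvd d"
  shows "affine_swap N i (j + d) = affine_swap N i j + d"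
proof -
  have "N dvd (j + d) - i \<longleftrightarrow> N dvd j - i" "N dvd (j + d) - i - 1 \<longleftrightarrow> N dvd j - i - 1"
    using dvd_add_left_iff[OF assms, of "j - i"] dvd_add_left_iff[OF assms, of "j - i - 1"]
    by (simp_all add: algebra_simps)
  then show ?thesis by (simp add: affine_swap_def)
qed

lemma affine_swap_cong:
  assumes "N dvd i - i'"
  shows "affine_swap N i = affine_swap N i'"
proof
  fix j
  have "N dvd j - i' \<longleftrightarrow> N dvd j - i" "N dvd j - i' - 1 \<longleftrightarrow> N dvd j - i - 1"
    using dvd_add_left_iff[OF assms, of "j - i"] dvd_add_left_iff[OF assms, of "j - i - 1"]
    by (simp_all add: algebra_simps)
  then show "affine_swap N i j = affine_swap N i' j" by (simp add: affine_swap_def)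
qed

lemma not_dvd_shift:
  fixes N :: int
  assumes "N dvd a" "\<bar>c\<bar> < N" "c \<noteq> 0"
  shows "\<not> N dvd a + c"
  using dvd_add_right_iff[OF assms(1), of c] dvd_imp_le_int[of c N] assms(2,3) by auto

lemma affine_swap_adjacent:
  assumes "3 \<le> N" "N dvd a - i"
  shows "affine_swap N i (a + 2) = a + 2"
    "affine_swap N (i + 1) a = a" "affine_swap N (i + 1) (a + 1) = a + 2"
    "affine_swap N (i + 1) (a + 2) = a + 1"
  using not_dvd_shift[OF assms(2), of 2] not_dvd_shift[OF assms(2), of 1]
    not_dvd_shift[OF assms(2), of "-1"] not_dvd_shift[OF assms(2), of "-2"] assms
  by (simp_all add: affine_swap_def algebra_simps)

text \<open>Both sides reverse each block \<open>a, a + 1, a + 2\<close> with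
  \<open>N dvd a - i\<close> and fix all other integers; \<open>3 \<le> N\<close> keeps the three
  residues distinct.\<close>

lemma affine_swap_braid:
  assumes "3 \<le> N"
  shows "affine_swap N i (affine_swap N (i + 1) (affine_swap N i j)) =
    affine_swap N (i + 1) (affine_swap N i (affine_swap N (i + 1) j))"
proof -
  have N: "2 \<le> N" using assms by simp
  note simps = affine_swap_adjacent[OF assms] affine_swap_left affine_swap_right[OF N]
  show ?thesis
  proof (cases rule: affine_swap_cases[of N j i])
    case 1
    then show ?thesis
      using affine_swap_adjacent(1,4)[OF assms 1] by (simp add: simps add.assoc)
  next
    case (2 a)
    then show ?thesis
      using 2 by (simp add: simps add.commute[of 2])
  next
    case 3
    show ?thesis
    proof (cases "N dvd j - i - 2")
      case True
      then obtain a where "N dvd a - i" "j = a + 2"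
        by (metis diff_add_cancel diff_right_commute)
      then show ?thesis by (simp add: simps)
    next
      case False
      then have "affine_swap N (i + 1) j = j"
        using 3 by (intro affine_swap_other) (simp_all add: algebra_simps)
      then show ?thesis using 3 by (simp add: affine_swap_other)
    qed
  qed
qed

lemma affine_swap_far:
  assumes "N dvd a - i" "\<not> N dvd k - i" "\<not> N dvd k - (i + 1)" "\<not> N dvd i - (k + 1)"
  shows "affine_swap N k a = a" "affine_swap N k (a + 1) = a + 1"
proof -
  have "\<not> N dvd a - k"
    using dvd_diff[OF assms(1), of "a - k"] assms(2) by auto
  moreover have "\<not> N dvd a + 1 - k"
    using dvd_diff[OF assms(1), of "a + 1 - k"] assms(3) by (auto simp: algebra_simps)
  moreover have "\<not> N dvd a - k - 1"
    using dvd_diff[of N "a - k - 1" "a - i"] assms(1,4) by (auto simp: algebra_simps)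
  ultimately show "affine_swap N k a = a" "affine_swap N k (a + 1) = a + 1"
    by (simp_all add: affine_swap_def algebra_simps)
qed

lemma affine_swap_commute:
  assumes "2 \<le> N" "\<not> N dvd k - i" "\<not> N dvd k - (i + 1)" "\<not> N dvd i - (k + 1)"
  shows "affine_swap N i (affine_swap N k j) = affine_swap N k (affine_swap N i j)"
proof -
  have "\<not> N dvd i - k" using assms(2) by (simp add: dvd_diff_commute)
  note far = affine_swap_far[of N _ i k, OF _ assms(2-4)] affine_swap_far[of N _ k i, OF _ this assms(4,3)]
  note swap = affine_swap_left affine_swap_right[OF assms(1)]
  show ?thesis
  proof (cases rule: affine_swap_cases[of N j i])
    case 3
    then show ?thesis
      by (cases rule: affine_swap_cases[of N j k]) (simp_all add: far swap affine_swap_other)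
  qed (simp_all add: far swap)
qed

text \<open>The first letter acts first, so passing from \<open>xs\<close> to \<open>s # xs\<close>
  exchanges the values at \<open>s\<close> and \<open>s + 1\<close> and at their translates. Left
  descents thus become comparisons of neighbouring values.\<close>

fun affine_perm :: "nat \<Rightarrow> nat list \<Rightarrow> int \<Rightarrow> int" where
  "affine_perm n [] j = j"
| "affine_perm n (x # xs) j = affine_perm n xs (affine_swap (int n + 1) (int x) j)"

lemma affine_perm_append: "affine_perm n (xs @ ys) j = affine_perm n ys (affine_perm n xs j)"
  by (induction xs arbitrary: j) auto

lemma affine_perm_shift:
  "int n + 1 dvd d \<Longrightarrow> affine_perm n xs (j + d) = affine_perm n xs j + d"
  by (induction xs arbitrary: j) (auto simp: affine_swap_shift)

lemma affine_perm_shift_mult: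
  "affine_perm n xs (j + (int n + 1) * k) = affine_perm n xs j + (int n + 1) * k"
  by (rule affine_perm_shift) simp

text \<open>Each letter moves an integer by at most one. The bound decides later how far the
  multiples of the period have to be moved down.\<close>

lemma abs_affine_perm_diff_le: "\<bar>affine_perm n xs j - j\<bar> \<le> int (length xs)"
proof (induction xs arbitrary: j)
  case (Cons x xs)
  have "\<bar>affine_swap (int n + 1) (int x) j - j\<bar> \<le> 1" by (simp add: affine_swap_def)
  then show ?case using Cons[of "affine_swap (int n + 1) (int x) j"] by simp
qed simp

lemma affine_perm_step_less:
  assumes "affine_perm n xs i < affine_perm n xs (i + 1)" "int n + 1 dvd a - i"
  shows "affine_perm n xs a < affine_perm n xs (a + 1)"
  using assms affine_perm_shift[OF assms(2), of xs i] affine_perm_shift[OF assms(2), of xs "i + 1"]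
  by (simp add: algebra_simps)

section \<open>The action respects the Coxeter relations\<close>

lemma affA_matrix_commute: "affA_matrix n s t = affA_matrix n t s"
  by (auto simp: affA_matrix_def insert_commute)

text \<open>Adjacency on the cycle is put as a congruence modulo \<open>n + 1\<close>. This absorbs
  the edge between \<open>1\<close> and \<open>n + 1\<close> and is the form that
  \<open>affine_swap_cong\<close> and \<open>affine_swap_commute\<close> take as input.\<close>

lemma affA_matrix_cases:
  assumes "s \<in> affA_index n" "t \<in> affA_index n" "1 \<le> n"
  obtains (same) "s = t" "affA_matrix n s t = 1"
  | (infinite) "n = 1" "s \<noteq> t" "affA_matrix n s t = 0"
  | (right) "2 \<le> n" "s \<noteq> t" "int n + 1 dvd int t - (int s + 1)" "affA_matrix n s t = 3"
  | (left) "2 \<le> n" "s \<noteq> t" "int n + 1 dvd int s - (int t + 1)" "affA_matrix n s t = 3"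
  | (far) "2 \<le> n" "s \<noteq> t" "\<not> int n + 1 dvd int t - int s" "\<not> int n + 1 dvd int t - (int s + 1)"
      "\<not> int n + 1 dvd int s - (int t + 1)" "affA_matrix n s t = 2"
proof -
  have range: "1 \<le> s" "s \<le> n + 1" "1 \<le> t" "t \<le> n + 1" using assms by (auto simp: affA_index_def)
  consider "s = t" | "s \<noteq> t" "n = 1" | "s \<noteq> t" "2 \<le> n" "t = s + 1" | "s \<noteq> t" "2 \<le> n" "s = t + 1"
    | "s \<noteq> t" "2 \<le> n" "s = n + 1" "t = 1" | "s \<noteq> t" "2 \<le> n" "s = 1" "t = n + 1"
    | "s \<noteq> t" "2 \<le> n" "t \<noteq> s + 1" "s \<noteq> t + 1" "{s, t} \<noteq> {1, n + 1}"
    using assms(3) by (fastforce simp: doubleton_eq_iff)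
  then show ?thesis
  proof cases
    case 7
    have not_dvd: "\<not> int n + 1 dvd c" if "\<bar>c\<bar> < int n + 1" "c \<noteq> 0" for c
      using not_dvd_shift[of "int n + 1" 0 c] that by simp
    have "s \<noteq> n + 1 \<or> t \<noteq> 1" "s \<noteq> 1 \<or> t \<noteq> n + 1" using 7(5) by auto
    then have "\<not> int n + 1 dvd int t - int s" "\<not> int n + 1 dvd int t - (int s + 1)"
      "\<not> int n + 1 dvd int s - (int t + 1)"
      using 7(1,3,4) range by (intro not_dvd; arith)+
    then show ?thesis using 7 that(5) by (simp add: affA_matrix_def)
  next
    case 5
    then have "int t - (int s + 1) = - (int n + 1)" by simp
    then have "int n + 1 dvd int t - (int s + 1)" by (simp only: dvd_minus_iff dvd_refl)
    then show ?thesis using 5 that(3) by (simp add: affA_matrix_def insert_commute)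
  next
    case 6
    then have "int s - (int t + 1) = - (int n + 1)" by simp
    then have "int n + 1 dvd int s - (int t + 1)" by (simp only: dvd_minus_iff dvd_refl)
    then show ?thesis using 6 that(4) by (simp add: affA_matrix_def insert_commute)
  qed (use that in \<open>auto simp: affA_matrix_def\<close>)
qed


lemma affA_words: "coxeter_words (affA_index n) (affA_matrix n)"
  by unfold_locales (simp add: affA_matrix_def)

lemma affine_perm_relation:
  assumes "s \<in> affA_index n" "t \<in> affA_index n" "1 \<le> n"
  shows "affine_perm n (concat (replicate (affA_matrix n s t) [s, t])) j = j"
proof -
  have N: "2 \<le> int n + 1" using assms by simp
  note inv = affine_swap_involution[OF N]
  show ?thesis
  using assms proof (cases rule: affA_matrix_cases)
    case same
    then show ?thesis by (simp add: inv)
  next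
    case infinite
    then show ?thesis by simp
  next
    case right
    then have "3 \<le> int n + 1" by simp
    note braid = affine_swap_braid[OF this, of "int s"]
    show ?thesis using right(4)
      by (simp add: numeral_3_eq_3 affine_swap_cong[OF right(3)] braid inv)
  next
    case left
    then have "3 \<le> int n + 1" by simp
    note braid = affine_swap_braid[OF this, of "int t"]
    show ?thesis using left(4)
      by (simp add: numeral_3_eq_3 affine_swap_cong[OF left(3)] braid inv)
  next
    case far
    show ?thesis using far(6)
      by (simp add: numeral_2_eq_2 affine_swap_commute[OF N far(3-5)] inv)
  qed
qed

lemma affine_perm_cong:
  assumes "cox_eq (affA_index n) (affA_matrix n) xs ys" "1 \<le> n"
  shows "affine_perm n xs = affine_perm n ys"
  using assms
proof (induction rule: cox_eq.induct)
  case (cox_rel xs ys s t)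
  then show ?case by (intro ext) (simp add: affine_perm_append affine_perm_relation)
qed simp_all


section \<open>Length against order: the ascent criterion and faithfulness of the action\<close>

lemma strict_mono_int_step:
  fixes f :: "int \<Rightarrow> int"
  assumes "\<And>a. f a < f (a + 1)"
  shows "strict_mono f"
proof
  fix a b :: int
  assume "a < b"
  then show "f a < f b"
    by (induction b rule: int_gr_induct) (use assms in \<open>auto intro: less_trans\<close>)
qed

lemma distinct_adj_decomp:
  "\<not> distinct_adj xs \<Longrightarrow> \<exists>as x bs. xs = as @ x # x # bs"
proof (induction xs rule: induct_list012)
  case (3 x y zs)
  show ?case
  proof (cases "x = y")
    case True
    then show ?thesis by (intro exI[of _ "[]"]) auto
  next
    case False
    then show ?thesis using 3 by (metis append_Cons distinct_adj_Cons_Cons)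
  qed
qed auto

text \<open>In the infinite dihedral case every letter of an alternating word pushes the two points
  one step further apart. The first letter \<open>t\<close> differs from \<open>s\<close> and sends
  \<open>s\<close> and \<open>s + 1\<close> to translates of \<open>t\<close> and
  \<open>t + 1\<close>, so the induction continues with \<open>t\<close> in place of
  \<open>s\<close>.\<close>

lemma affine_perm_alternating:
  assumes "distinct_adj u" "u \<in> lists {1, 2}" "s \<in> {1, 2}" "u \<noteq> [] \<Longrightarrow> hd u \<noteq> s"
  shows "\<exists>k\<ge>0. affine_perm 1 u (int s) = int s - k \<and> affine_perm 1 u (int s + 1) = int s + 1 + k"
  using assms
proof (induction u arbitrary: s)
  case Nil
  then show ?case by (intro exI[of _ 0]) simp
next
  case (Cons t u)
  have t: "t \<in> {1, 2}" "t \<noteq> s" using Cons.prems by auto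
  have "distinct_adj u" "u \<noteq> [] \<Longrightarrow> hd u \<noteq> t"
    using Cons.prems(1) by (auto simp: distinct_adj_Cons)
  with Cons.IH[of t] Cons.prems t obtain k where
    k: "k \<ge> 0" "affine_perm 1 u (int t) = int t - k" "affine_perm 1 u (int t + 1) = int t + 1 + k"
    by auto
  have swap: "affine_swap 2 (int t) (int s) = int s - 1" "affine_swap 2 (int t) (int s + 1) = int s + 2"
    using t Cons.prems(3) by (auto simp: affine_swap_def)
  have "affine_perm 1 u (int s - 1) = int s - 1 - k" "affine_perm 1 u (int s + 2) = int s + 2 + k"
    using k affine_perm_shift[of 1 "int s - 1 - int t" u "int t"]
      affine_perm_shift[of 1 "int s + 1 - int t" u "int t + 1"] t Cons.prems(3) by auto
  then show ?case using k(1) swap by (intro exI[of _ "k + 1"]) simp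
qed

text \<open>Induction on the length. The dihedral factorisation gives \<open>u @ v\<close>, where
  \<open>v\<close> increases from \<open>s\<close> to \<open>s + 1\<close> and from \<open>t\<close>
  to \<open>t + 1\<close> by induction. The letters of \<open>u\<close> act first; \<open>u\<close>
  alternates, and every expression of it that begins with \<open>s\<close> is longer than
  \<open>u\<close>. So it can only take \<open>s\<close> and \<open>s + 1\<close> to two points in
  the same order, on which \<open>v\<close> is already known to increase.\<close>

lemma affine_perm_less_of_word_length:
  assumes "1 \<le> n" "xs \<in> lists (affA_index n)" "s \<in> affA_index n"
    and "word_length (affA_index n) (affA_matrix n) xs < word_length (affA_index n) (affA_matrix n) (s # xs)"
  shows "affine_perm n xs (int s) < affine_perm n xs (int s + 1)"
  using assms(2-)
proof (induction "word_length (affA_index n) (affA_matrix n) xs" arbitrary: xs s rule: less_induct)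
  case less
  let ?S = "affA_index n" and ?m = "affA_matrix n" and ?N = "int n + 1"
  interpret coxeter_words ?S ?m by (rule affA_words)
  show ?case
  proof (cases "len xs = 0")
    case True
    obtain ys where "eq xs (ys)" "length ys = len xs" using reduced_word_exists[OF less.prems(1)] .
    then show ?thesis using True affine_perm_cong[of n xs ys] assms(1) by simp
  next
    case False
    then obtain t u v where t: "t \<in> ?S" "t \<noteq> s" and u: "u \<in> lists {s, t}" and v: "v \<in> lists ?S"
      and xs: "eq xs (u @ v)" and len_v: "len v < len xs" "len v < len (s # v)" "len v < len (t # v)"
      and min: "\<And>u'. eq u u' \<Longrightarrow> length u \<le> length u'" "\<And>u'. eq u (s # u') \<Longrightarrow> length u \<le> length u'"
      using dihedral_factorisation[OF less.prems] by blast
    have uS: "u \<in> lists ?S" using u t(1) less.prems(2) by auto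
    have up: "affine_perm n v (int r) < affine_perm n v (int r + 1)" if "r \<in> {s, t}" for r
      using that less.hyps[OF len_v(1) v] len_v less.prems(2) t(1) by blast
    have up_s: "affine_perm n v a < affine_perm n v (a + 1)" if "?N dvd a - int s" for a
      using affine_perm_step_less[OF up that] by simp
    have up_t: "affine_perm n v a < affine_perm n v (a + 1)" if "?N dvd a - int t" for a
      using affine_perm_step_less[OF up that] by simp
    have perm: "affine_perm n xs j = affine_perm n v (affine_perm n u j)" for j
      using affine_perm_cong[OF xs assms(1)] by (simp add: affine_perm_append)
    have hd_u: "hd u \<noteq> s" if "u \<noteq> []"
      using min(2)[of "tl u"] that cox_eq.cox_refl[OF uS] by (cases u) auto
    have alt: "distinct_adj u"
    proof (rule ccontr)
      assume "\<not> distinct_adj u"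
      then obtain as x bs where "u = as @ [x, x] @ bs"
        by (metis append_Cons append_Nil distinct_adj_decomp)
      then show False using min(1)[of "as @ bs"] cancel[of x as bs] uS by simp
    qed
    have N: "2 \<le> ?N" using assms(1) by simp
    note swap = affine_swap_left affine_swap_right[OF N] affine_swap_other
    have u_forms: "u = [] \<or> u = [t] \<or> (\<exists>r. u = t # s # r)"
      using u hd_u alt by (cases u rule: list.exhaust; cases "tl u") auto
    \<comment> \<open>A third letter would allow \<open>t, s, t\<close> to be replaced by
      \<open>s, t, s\<close>, an expression of the same length beginning with
      \<open>s\<close>.\<close>
    have u_braid: "u = [] \<or> u = [t] \<or> u = [t, s]" if m: "?m s t = 3"
    proof (rule ccontr)
      assume "\<not> ?thesis"
      then obtain r where r: "u = t # s # t # r"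
        using u_forms u alt by (metis (no_types) distinct_adj_Cons_Cons emptyE insertE
            lists.cases list.inject neq_Nil_conv Cons_in_lists_iff)
      have "?m t s = 3" using m affA_matrix_commute[of n s t] by simp
      then have "eq u (s # t # s # r)"
        using cox_eq_context[OF braid3[OF less.prems(2) t(1)], of "[]" r] uS r by simp
      then show False using min(2)[of "t # s # r"] r by simp
    qed
    from less.prems(2) t(1) assms(1) show ?thesis
    proof (cases rule: affA_matrix_cases)
      case same
      then show ?thesis using t by simp
    next
      case infinite
      then have st: "{s, t} = {1, 2}" using less.prems(2) t(1) by (auto simp: affA_index_def)
      then obtain k where k: "k \<ge> 0" "affine_perm 1 u (int s) = int s - k"
        "affine_perm 1 u (int s + 1) = int s + 1 + k"
        using affine_perm_alternating[OF alt, of s] u hd_u by auto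
      \<comment> \<open>With period 2 every integer is congruent to \<open>s\<close> or
        \<open>t\<close>, so \<open>v\<close> increases at every step, while \<open>u\<close> only
        pushes the images of \<open>s\<close> and \<open>s + 1\<close> apart.\<close>
      have "?N dvd a - int s \<or> ?N dvd a - int t" for a
        using st infinite(1) by (auto simp: doubleton_eq_iff)
      then have "strict_mono (affine_perm n v)"
        by (intro strict_mono_int_step) (use up_s up_t in blast)
      then show ?thesis
        using k infinite(1) perm[of "int s"] perm[of "int s + 1"] by (simp add: strict_mono_less)
    next
      case far
      have "u = [] \<or> u = [t]"
      proof (rule ccontr)
        assume "\<not> ?thesis"
        then obtain r where r: "u = t # s # r" using u_forms by blast
        have "?m t s = 2" using far(6) affA_matrix_commute[of n s t] by simp
        then have "eq u (s # t # r)"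
          using cox_eq_context[OF braid2[OF less.prems(2) t(1)], of "[]" r] uS r by simp
        then show False using min(2)[of "t # r"] r by simp
      qed
      moreover have "affine_swap ?N (int t) (int s) = int s"
        "affine_swap ?N (int t) (int s + 1) = int s + 1"
        using affine_swap_far[of ?N "int s" "int s" "int t"] far by auto
      ultimately show ?thesis using up_s[of "int s"] by (auto simp: perm)
    next
      case right
      have three: "3 \<le> ?N" using right by simp
      \<comment> \<open>Here \<open>t\<close> acts as \<open>s + 1\<close>. For \<open>u\<close>
        equal to \<open>[]\<close>, \<open>[t]\<close> or \<open>[t, s]\<close> the pair
        \<open>(s, s + 1)\<close> goes to \<open>(s, s + 1)\<close>, \<open>(s, s + 2)\<close> or
        \<open>(s + 1, s + 2)\<close>.\<close>
      have "affine_perm n v (int s) < affine_perm n v (int s + 1)"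
        "affine_perm n v (int s + 1) < affine_perm n v (int s + 2)"
        using up_s[of "int s"] up_t[of "int s + 1"] right(3) by (simp_all add: dvd_diff_commute add.commute[of 2])
      then show ?thesis
        using u_braid[OF right(4)] affine_swap_adjacent[OF three, of "int s" "int s"]
        by (auto simp: perm affine_swap_cong[OF right(3)] swap add.commute[of 2])
    next
      case left
      have three: "3 \<le> ?N" using left by simp
      have dvd: "?N dvd (int s - 1) - int t" using left(3) by (simp add: algebra_simps)
      \<comment> \<open>The mirror image: the pair goes to \<open>(s, s + 1)\<close>,
        \<open>(s - 1, s + 1)\<close> or \<open>(s - 1, s)\<close>.\<close>
      have "affine_perm n v (int s - 1) < affine_perm n v (int s)"
        "affine_perm n v (int s) < affine_perm n v (int s + 1)"
        using up_s[of "int s"] up_t[OF dvd] by simp_all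
      then show ?thesis
        using u_braid[OF left(4)] affine_swap_adjacent[OF three dvd] affine_swap_right[OF N dvd]
        by (auto simp: perm affine_swap_cong[OF left(3)] swap add.commute[of 1 "int s"])
    qed
  qed
qed

text \<open>The lengths of \<open>xs\<close> and \<open>s # xs\<close> never agree, so otherwise
  \<open>s\<close> would lengthen \<open>s # xs\<close>. The converse implication then orders the
  values of \<open>s # xs\<close> at \<open>s\<close> and \<open>s + 1\<close>, which are those of
  \<open>xs\<close> exchanged.\<close>

lemma word_length_Cons_of_affine_perm_less:
  assumes "1 \<le> n" "xs \<in> lists (affA_index n)" "s \<in> affA_index n"
    and "affine_perm n xs (int s) < affine_perm n xs (int s + 1)"
  shows "word_length (affA_index n) (affA_matrix n) xs < word_length (affA_index n) (affA_matrix n) (s # xs)"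
proof (rule ccontr)
  interpret coxeter_words "affA_index n" "affA_matrix n" by (rule affA_words)
  assume "\<not> ?thesis"
  then have "len (s # xs) < len (s # s # xs)"
    using len_Cons_neq[OF assms(3,2)] word_length_cong[OF cancel_Cons[OF assms(3,2)]] by simp
  then have "affine_perm n (s # xs) (int s) < affine_perm n (s # xs) (int s + 1)"
    using assms by (intro affine_perm_less_of_word_length) auto
  moreover have "2 \<le> int n + 1" using assms(1) by simp
  ultimately show False
    using assms(4) by (simp add: affine_swap_left affine_swap_right)
qed

text \<open>If a reduced expression had a first letter \<open>t\<close>, its tail would increase
  from \<open>t\<close> to \<open>t + 1\<close> by reducedness, but decrease there because the whole
  word acts trivially.\<close>

lemma cox_eq_Nil_of_affine_perm_id:
  assumes "1 \<le> n" "xs \<in> lists (affA_index n)" "\<And>j. affine_perm n xs j = j"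
  shows "cox_eq (affA_index n) (affA_matrix n) xs []"
proof -
  interpret coxeter_words "affA_index n" "affA_matrix n" by (rule affA_words)
  obtain ys where ys: "cox_eq (affA_index n) (affA_matrix n) xs ys" "length ys = len xs"
    using reduced_word_exists[OF assms(2)] .
  have "ys = []"
  proof (cases ys)
    case (Cons t zs)
    then have t: "t \<in> affA_index n" "zs \<in> lists (affA_index n)" using cox_eq_in_lists[OF ys(1)] by auto
    have "len zs \<le> length zs" by (intro word_length_le cox_eq.cox_refl t(2))
    then have "len zs < len (t # zs)" using word_length_cong[OF ys(1)] ys(2) Cons by simp
    then have "affine_perm n zs (int t) < affine_perm n zs (int t + 1)"
      using assms(1) t by (intro affine_perm_less_of_word_length) auto
    moreover have "affine_perm n (t # zs) j = j" for j
      using affine_perm_cong[OF ys(1) assms(1)] assms(3) Cons by metis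
    from this[of "int t"] this[of "int t + 1"]
    have "affine_perm n zs (int t + 1) = int t" "affine_perm n zs (int t) = int t + 1"
      using assms(1) by (simp_all add: affine_swap_left affine_swap_right)
    ultimately show ?thesis by simp
  qed
  then show ?thesis using ys by simp
qed

lemma affine_perm_faithful:
  assumes "1 \<le> n" "xs \<in> lists (affA_index n)" "ys \<in> lists (affA_index n)"
    and "affine_perm n xs = affine_perm n ys"
  shows "cox_eq (affA_index n) (affA_matrix n) xs ys"
proof -
  interpret coxeter_words "affA_index n" "affA_matrix n" by (rule affA_words)
  have rev: "rev ys \<in> lists (affA_index n)" using assms(3) by auto
  have "affine_perm n (rev ys @ xs) j = j" for j
    using affine_perm_cong[OF rev_cancel[OF assms(3)] assms(1)]
    by (metis affine_perm.simps(1) affine_perm_append assms(4))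
  then have "eq (rev ys @ xs) []"
    using assms(1,2) rev by (intro cox_eq_Nil_of_affine_perm_id) auto
  then have 1: "eq (ys @ rev ys @ xs) ys"
    using cox_eq_append[OF cox_eq.cox_refl[OF assms(3)]] by fastforce
  have "eq (ys @ rev ys) []" using rev_cancel[OF rev] by simp
  then have 2: "eq (ys @ rev ys @ xs) xs"
    using cox_eq_append[OF _ cox_eq.cox_refl[OF assms(2)], of _ "ys @ rev ys" "[]"] by simp
  show ?thesis by (rule cox_eq.cox_trans[OF cox_eq.cox_sym[OF 2] 1])
qed

section \<open>Inserting a fixed residue class\<close>

text \<open>The increasing enumeration of the integers not divisible by \<open>n + 1\<close>, with 1 at 1.\<close>

definition skip :: "nat \<Rightarrow> int \<Rightarrow> int" where
  "skip n j = j + (j - 1) div int n"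

lemma strict_mono_skip: "strict_mono (skip n)"
proof (rule strict_monoI)
  fix i j :: int
  assume "i < j"
  then have "(i - 1) div int n \<le> (j - 1) div int n"
    by (cases "n = 0") (auto intro: zdiv_mono1)
  then show "skip n i < skip n j" using \<open>i < j\<close> by (simp add: skip_def)
qed

lemma skip_shift: "1 \<le> n \<Longrightarrow> skip n (j + int n * k) = skip n j + (int n + 1) * k"
proof -
  assume "1 \<le> n"
  then have "(j + int n * k - 1) div int n = (j - 1) div int n + k"
    using div_mult_self2[of "int n" "j - 1" k] by (simp add: algebra_simps)
  then show ?thesis by (simp add: skip_def algebra_simps)
qed

lemma skip_base: "1 \<le> j \<Longrightarrow> j \<le> int n \<Longrightarrow> skip n j = j"
  by (simp add: skip_def)

lemma residue_cases:
  assumes "1 \<le> n"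
  obtains r k where "1 \<le> r" "r \<le> int n" "j = r + int n * k"
proof
  show "1 \<le> (j - 1) mod int n + 1" "(j - 1) mod int n + 1 \<le> int n"
    using assms pos_mod_bound[of "int n" "j - 1"] pos_mod_sign[of "int n" "j - 1"] by linarith+
  show "j = ((j - 1) mod int n + 1) + int n * ((j - 1) div int n)"
    by (simp add: algebra_simps)
qed

lemma affine_swap_base:
  assumes "1 \<le> i" "i < N" "1 \<le> j" "j \<le> N"
  shows "affine_swap N i j = (if j = i then i + 1 else if j = i + 1 then i else j)"
  using not_dvd_shift[of N 0 "j - i"] not_dvd_shift[of N 0 "j - i - 1"] assms
  by (auto simp: affine_swap_def)

lemma affine_swap_base_last:
  assumes "2 \<le> N" "1 \<le> j" "j \<le> N"
  shows "affine_swap N N j = (if j = N then N + 1 else if j = 1 then 0 else j)"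
proof -
  have "N dvd j - N \<longleftrightarrow> j = N" "N dvd j - N - 1 \<longleftrightarrow> j = 1"
    using assms not_dvd_shift[of N 0 "j - N"] not_dvd_shift[of N "- N" "j - 1"]
    by (auto simp: algebra_simps)
  then show ?thesis by (simp add: affine_swap_def)
qed

text \<open>The embedding \<open>\<phi>\<close> on generators. A reflection is its own inverse, so
  conjugating \<open>a_{n+1}\<close> by \<open>\<sigma>_n\<close> gives the palindrome
  \<open>[n, n + 1, n]\<close>. It exchanges \<open>n\<close> and \<open>n + 2\<close>, which are
  neighbours once the multiples of \<open>n + 1\<close> are left out.\<close>

definition embed_gen :: "nat \<Rightarrow> nat \<Rightarrow> nat list" where
  "embed_gen n i = (if i < n then [i] else [n, n + 1, n])"

definition embed_word :: "nat \<Rightarrow> nat list \<Rightarrow> nat list" where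
  "embed_word n xs = concat (map (embed_gen n) xs)"

lemma embed_word_Cons: "embed_word n (x # xs) = embed_gen n x @ embed_word n xs"
  by (simp add: embed_word_def)

lemma embed_word_in_lists:
  "2 \<le> n \<Longrightarrow> xs \<in> lists (affA_index (n - 1)) \<Longrightarrow> embed_word n xs \<in> lists (affA_index n)"
  by (induction xs) (auto simp: embed_word_def embed_gen_def affA_index_def)

text \<open>Both sides are compatible with translation, by \<open>n\<close> before
  \<open>skip\<close> and by \<open>n + 1\<close> after it, so a check on the base period
  suffices.\<close>

lemma affine_perm_embed_gen_skip:
  assumes "2 \<le> n" "1 \<le> i" "i \<le> n"
  shows "affine_perm n (embed_gen n i) (skip n j) = skip n (affine_swap (int n) (int i) j)"
proof -
  have base: "affine_perm n (embed_gen n i) r = skip n (affine_swap (int n) (int i) r)"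
    if r: "1 \<le> r" "r \<le> int n" for r
  proof (cases "i = n")
    case False
    then show ?thesis
      using assms r by (auto simp: embed_gen_def affine_swap_base skip_base)
  next
    case True
    have skip: "skip n 0 = - 1" "skip n (int n + 1) = int n + 2"
      using assms(1) by (simp_all add: skip_def div_eq_minus1)
    \<comment> \<open>Two points leave the base period under the palindrome: \<open>1\<close> goes
      through \<open>0\<close> to \<open>-1\<close>, and \<open>n\<close> goes through
      \<open>n + 1\<close> to \<open>n + 2\<close>. The last swap is evaluated there by
      congruence.\<close>
    have "- 1 - int n = - (int n + 1)" by simp
    then have "int n + 1 dvd - 1 - int n" by (simp only: dvd_minus_iff dvd_refl)
    then have zero: "affine_swap (int n + 1) (int n) 0 = - 1"
      "affine_swap (int n + 1) (int n) (int n + 2) = int n + 2"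
      using affine_swap_right[of "int n + 1" "- 1" "int n"]
        affine_swap_adjacent(1)[of "int n + 1" "int n" "int n"] assms(1) by simp_all
    show ?thesis
      using True assms r skip zero
      by (auto simp: embed_gen_def affine_swap_base affine_swap_base_last skip_base
          add.commute[of 1] add.commute[of 2])
  qed
  obtain r k where r: "1 \<le> r" "r \<le> int n" "j = r + int n * k"
    using residue_cases[of n j] assms(1) by auto
  then show ?thesis
    using base[of r] assms(1) affine_perm_shift[of n "(int n + 1) * k" "embed_gen n i" r]
      affine_swap_shift[of "int n" "int n * k" "int i" r]
    by (simp add: skip_shift skip_base)
qed

lemma affine_perm_embed_gen_fixed:
  assumes "2 \<le> n" "1 \<le> i" "i \<le> n"
  shows "affine_perm n (embed_gen n i) ((int n + 1) * k) = (int n + 1) * k"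
proof -
  have "affine_perm n (embed_gen n i) (int n + 1) = int n + 1"
  proof (cases "i = n")
    case False
    then show ?thesis using assms by (simp add: embed_gen_def affine_swap_base)
  next
    case True
    then show ?thesis using assms by (simp add: embed_gen_def affine_swap_base affine_swap_base_last add.commute[of 1])
  qed
  moreover have "(int n + 1) * k = (int n + 1) + (int n + 1) * (k - 1)" by (simp add: algebra_simps)
  ultimately show ?thesis by (metis affine_perm_shift_mult)
qed

lemma affine_perm_embed_word:
  assumes "2 \<le> n" "xs \<in> lists (affA_index (n - 1))"
  shows "affine_perm n (embed_word n xs) (skip n j) = skip n (affine_perm (n - 1) xs j)"
    and "affine_perm n (embed_word n xs) ((int n + 1) * k) = (int n + 1) * k"
proof -
  have "int (n - 1) + 1 = int n" using assms(1) by simp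
  then show "affine_perm n (embed_word n xs) (skip n j) = skip n (affine_perm (n - 1) xs j)"
    using assms(2)
    by (induction xs arbitrary: j) (auto simp: embed_word_def affine_perm_append
        affine_perm_embed_gen_skip[OF assms(1)] affA_index_def)
  show "affine_perm n (embed_word n xs) ((int n + 1) * k) = (int n + 1) * k"
    using assms(2)
    by (induction xs) (use assms(1) in \<open>auto simp: embed_word_def affine_perm_append
        affine_perm_embed_gen_fixed affA_index_def\<close>)
qed

text \<open>The word \<open>n, ..., 1, n + 1\<close>. For \<open>2 \<le> n\<close> it moves the
  integers not divisible by \<open>n + 1\<close> one place up in the enumeration
  \<open>skip\<close>, and the multiples of \<open>n + 1\<close> one period down. Over a period
  these displacements sum to zero, as they must for a product of generators. Its powers serve as the
  element \<open>y\<close>.\<close>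

definition shift_word :: "nat \<Rightarrow> nat list" where
  "shift_word n = rev [1..<n + 1] @ [n + 1]"

lemma affine_perm_cycle:
  "r \<le> n \<Longrightarrow> 1 \<le> j \<Longrightarrow> j \<le> int n + 1 \<Longrightarrow>
    affine_perm n (rev [1..<Suc r]) j = (if j \<le> int r then j + 1 else if j = int r + 1 then 1 else j)"
proof (induction r arbitrary: j)
  case (Suc r)
  have "rev [1..<Suc (Suc r)] = Suc r # rev [1..<Suc r]" by simp
  then show ?case
    using Suc by (simp add: affine_swap_base del: upt_Suc)
qed auto

lemma affine_perm_shift_word:
  assumes "2 \<le> n"
  shows "affine_perm n (shift_word n) (skip n j) = skip n (j + 1)"
    and "affine_perm n (shift_word n) ((int n + 1) * k) = (int n + 1) * (k - 1)"
proof -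
  have base: "affine_perm n (shift_word n) i = (if i < int n then i + 1 else if i = int n then int n + 2 else 0)"
    if "1 \<le> i" "i \<le> int n + 1" for i
    using that assms affine_perm_cycle[of n n i]
    by (auto simp: shift_word_def affine_perm_append affine_swap_base_last add.commute[of 1] simp del: upt_Suc)
  obtain r l where r: "1 \<le> r" "r \<le> int n" "j = r + int n * l"
    using residue_cases[of n j] assms by auto
  \<comment> \<open>At \<open>r = int n\<close> the successor leaves the base period:
    \<open>skip\<close> sends \<open>n + 1\<close> to \<open>n + 2\<close>, since the value
    \<open>n + 1\<close> is left out.\<close>
  have "skip n (r + 1) = affine_perm n (shift_word n) r"
    using r base[of r] skip_shift[of n 1 1] assms by (auto simp: skip_base add.commute)
  then have "skip n (r + 1) + (int n + 1) * l = affine_perm n (shift_word n) (r + (int n + 1) * l)"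
    by (simp only: affine_perm_shift_mult)
  moreover have "skip n (j + 1) = skip n (r + 1) + (int n + 1) * l" "skip n j = r + (int n + 1) * l"
    using r assms skip_shift[of n "r + 1" l] skip_shift[of n r l] by (simp_all add: skip_base add_ac)
  ultimately show "affine_perm n (shift_word n) (skip n j) = skip n (j + 1)" by simp
  have "affine_perm n (shift_word n) (int n + 1) = 0" using base[of "int n + 1"] by simp
  moreover have "(int n + 1) * k = (int n + 1) + (int n + 1) * (k - 1)" by (simp add: algebra_simps)
  ultimately show "affine_perm n (shift_word n) ((int n + 1) * k) = (int n + 1) * (k - 1)"
    by (metis affine_perm_shift_mult add_0)
qed

definition shift_power :: "nat \<Rightarrow> nat \<Rightarrow> nat list" where
  "shift_power n l = concat (replicate l (shift_word n))"

lemma shift_power_in_lists: "shift_power n l \<in> lists (affA_index n)"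
  by (induction l) (auto simp: shift_power_def shift_word_def affA_index_def)

lemma affine_perm_shift_power:
  assumes "2 \<le> n"
  shows "affine_perm n (shift_power n l) (skip n j) = skip n (j + int l)"
    and "affine_perm n (shift_power n l) ((int n + 1) * k) = (int n + 1) * (k - int l)"
proof -
  show "affine_perm n (shift_power n l) (skip n j) = skip n (j + int l)"
    by (induction l arbitrary: j)
      (simp_all add: shift_power_def affine_perm_append affine_perm_shift_word(1)[OF assms] add_ac)
  show "affine_perm n (shift_power n l) ((int n + 1) * k) = (int n + 1) * (k - int l)"
    by (induction l arbitrary: k)
      (simp_all add: shift_power_def affine_perm_append affine_perm_shift_word(2)[OF assms] diff_diff_eq)
qed

section \<open>Free modules\<close>

lemma lookup_scale: "Poly_Mapping.lookup (scale c x) w = c * Poly_Mapping.lookup x w"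
  by (simp add: scale_def Poly_Mapping.map.rep_eq when_def)

lemma scale_add_left: "scale (c + d) x = scale c x + scale d x"
  by (rule poly_mapping_eqI) (simp add: lookup_scale lookup_add distrib_right)

lemma scale_scale: "scale c (scale d x) = scale (c * d) x"
  by (rule poly_mapping_eqI) (simp add: lookup_scale mult.assoc)

lemma scale_one: "scale 1 x = x"
  by (rule poly_mapping_eqI) (simp add: lookup_scale)

lemma scale_in_free_module: "x \<in> free_module W \<Longrightarrow> scale c x \<in> free_module W"
  by (fastforce simp: free_module_def in_keys_iff lookup_scale)

lemma basis_elt_in_free_module: "w \<in> W \<Longrightarrow> basis_elt w \<in> free_module W"
  by (simp add: free_module_def basis_elt_def)

lemma add_in_free_module: "x \<in> free_module W \<Longrightarrow> y \<in> free_module W \<Longrightarrow> x + y \<in> free_module W"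
  unfolding free_module_def using keys_add[of x y] by auto

lemma free_module_induct [consumes 1, case_names zero add]:
  fixes x :: "'w \<Rightarrow>\<^sub>0 'k::{comm_ring, comm_monoid_mult}"
  assumes "x \<in> free_module W" and "P 0"
    and add: "\<And>x c w. x \<in> free_module W \<Longrightarrow> w \<in> W \<Longrightarrow> P x \<Longrightarrow> P (x + scale c (basis_elt w))"
  shows "P x"
proof -
  have "P y" if "finite A" "A \<subseteq> W" "Poly_Mapping.keys y \<subseteq> A" for A and y :: "'w \<Rightarrow>\<^sub>0 'k"
    using that
  proof (induction A arbitrary: y rule: finite_induct)
    case empty
    then have "y = 0" by (intro poly_mapping_eqI) (auto simp: in_keys_iff)
    then show ?case using \<open>P 0\<close> by simp
  next
    case (insert a A)
    \<comment> \<open>Removing the term at \<open>a\<close> moves the support into \<open>A\<close>.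
      The induction runs over a set containing the support, so the coefficient at \<open>a\<close>
      may be zero.\<close>
    define z where "z = y + scale (- Poly_Mapping.lookup y a) (basis_elt a)"
    have lookup_z: "Poly_Mapping.lookup z w = (if w = a then 0 else Poly_Mapping.lookup y w)" for w
      by (simp add: z_def lookup_add lookup_scale basis_elt_def lookup_single when_def)
    then have "Poly_Mapping.keys z \<subseteq> A" using insert.prems by (auto simp: in_keys_iff split: if_splits)
    then have "P z" "z \<in> free_module W" using insert by (auto simp: free_module_def)
    moreover have "y = z + scale (Poly_Mapping.lookup y a) (basis_elt a)"
      by (rule poly_mapping_eqI) (auto simp: lookup_z lookup_add lookup_scale basis_elt_def lookup_single when_def)
    ultimately show ?case using add[of z a "Poly_Mapping.lookup y a"] insert.prems by auto
  qed
  from this[of "Poly_Mapping.keys x" x] show ?thesis using assms(1) by (simp add: free_module_def)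
qed

text \<open>Since \<open>\<psi>\<close> is injective, the term at \<open>v\<close> contributes to
  the coefficient at \<open>\<psi> w\<close> only if \<open>v = w\<close>. Reading off coefficients
  works over every coefficient ring, the zero ring included.\<close>

lemma lookup_of_basis_injection:
  fixes \<Phi> :: "('v \<Rightarrow>\<^sub>0 'k) \<Rightarrow> ('w \<Rightarrow>\<^sub>0 'k::{comm_ring, comm_monoid_mult})"
  assumes "x \<in> free_module W" "inj_on \<psi> W" "\<Phi> 0 = 0"
    and "\<And>x y. x \<in> free_module W \<Longrightarrow> y \<in> free_module W \<Longrightarrow> \<Phi> (x + y) = \<Phi> x + \<Phi> y"
    and "\<And>c x. x \<in> free_module W \<Longrightarrow> \<Phi> (scale c x) = scale c (\<Phi> x)"
    and "\<And>w. w \<in> W \<Longrightarrow> \<Phi> (basis_elt w) = basis_elt (\<psi> w)"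
    and "w \<in> W"
  shows "Poly_Mapping.lookup (\<Phi> x) (\<psi> w) = Poly_Mapping.lookup x w"
  using assms(1)
proof (induction rule: free_module_induct)
  case (add x c v)
  have "\<psi> v = \<psi> w \<longleftrightarrow> v = w" using assms(2,7) add(2) by (auto dest: inj_onD)
  moreover have "\<Phi> (x + scale c (basis_elt v)) = \<Phi> x + scale c (basis_elt (\<psi> v))"
    using add(1,2) by (simp add: assms(4-6) basis_elt_in_free_module scale_in_free_module)
  ultimately show ?case
    using add(3) by (simp add: lookup_add lookup_scale basis_elt_def lookup_single when_def)
qed (simp add: assms(3))

section \<open>Affine Hecke algebras\<close>

locale affine_hecke =
  fixes n :: nat and q :: "'k::{comm_ring, comm_monoid_mult}"
    and H :: "('k, nat list set \<Rightarrow>\<^sub>0 'k) module"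
  assumes n: "1 \<le> n" and hecke: "is_affine_hecke n q H" and q_unit: "q dvd 1"
begin

abbreviation "S \<equiv> affA_index n"
abbreviation "cls \<equiv> cox_class S (affA_matrix n)"

definition T :: "nat list \<Rightarrow> (nat list set \<Rightarrow>\<^sub>0 'k)" where
  "T xs = basis_elt (cls xs)"

sublocale coxeter_words S "affA_matrix n"
  by (rule affA_words)

sublocale ring H
  using hecke by (simp add: is_affine_hecke_def algebra_on_free_module_def)

lemma carrier_eq: "carrier H = free_module (carrier (affA n))"
  and zero_eq: "\<zero>\<^bsub>H\<^esub> = 0"
  and add_eq: "x \<in> carrier H \<Longrightarrow> y \<in> carrier H \<Longrightarrow> x \<oplus>\<^bsub>H\<^esub> y = x + y"
  and smult_eq: "x \<in> carrier H \<Longrightarrow> c \<odot>\<^bsub>H\<^esub> x = scale c x"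
  using hecke by (simp_all add: is_affine_hecke_def algebra_on_free_module_def)

lemma scale_closed: "x \<in> carrier H \<Longrightarrow> scale c x \<in> carrier H"
  by (simp add: carrier_eq scale_in_free_module)

lemma add_closed: "x \<in> carrier H \<Longrightarrow> y \<in> carrier H \<Longrightarrow> x + y \<in> carrier H"
  by (simp add: carrier_eq add_in_free_module)

lemma scale_mult:
  assumes "x \<in> carrier H" "y \<in> carrier H"
  shows "scale c x \<otimes>\<^bsub>H\<^esub> y = scale c (x \<otimes>\<^bsub>H\<^esub> y)" "x \<otimes>\<^bsub>H\<^esub> scale c y = scale c (x \<otimes>\<^bsub>H\<^esub> y)"
proof -
  have "(c \<odot>\<^bsub>H\<^esub> x) \<otimes>\<^bsub>H\<^esub> y = c \<odot>\<^bsub>H\<^esub> (x \<otimes>\<^bsub>H\<^esub> y)"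
    "x \<otimes>\<^bsub>H\<^esub> (c \<odot>\<^bsub>H\<^esub> y) = c \<odot>\<^bsub>H\<^esub> (x \<otimes>\<^bsub>H\<^esub> y)"
    using hecke assms unfolding is_affine_hecke_def algebra_on_free_module_def by blast+
  then show "scale c x \<otimes>\<^bsub>H\<^esub> y = scale c (x \<otimes>\<^bsub>H\<^esub> y)" "x \<otimes>\<^bsub>H\<^esub> scale c y = scale c (x \<otimes>\<^bsub>H\<^esub> y)"
    using assms by (simp_all add: smult_eq)
qed

lemma add_mult:
  assumes "x \<in> carrier H" "y \<in> carrier H" "z \<in> carrier H"
  shows "(x + y) \<otimes>\<^bsub>H\<^esub> z = x \<otimes>\<^bsub>H\<^esub> z + y \<otimes>\<^bsub>H\<^esub> z"
    "z \<otimes>\<^bsub>H\<^esub> (x + y) = z \<otimes>\<^bsub>H\<^esub> x + z \<otimes>\<^bsub>H\<^esub> y"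
  using l_distr[OF assms] r_distr[OF assms] assms by (simp_all add: add_eq)

lemma carrier_affA: "carrier (affA n) = cls ` lists S"
  by (simp add: affA_def coxeter_group_def)

lemma T_closed: "xs \<in> lists S \<Longrightarrow> T xs \<in> carrier H"
  by (simp add: T_def carrier_eq carrier_affA basis_elt_in_free_module)

lemma T_cong: "eq xs ys \<Longrightarrow> T xs = T ys"
  using cox_class_eq_iff[of xs S "affA_matrix n" ys] cox_eq_in_lists[of S "affA_matrix n" xs ys]
  by (simp add: T_def)

lemma mult_rule:
  assumes "s \<in> S" "xs \<in> lists S"
  shows "len xs < len (s # xs) \<Longrightarrow> T [s] \<otimes>\<^bsub>H\<^esub> T xs = T (s # xs)"
    and "len (s # xs) < len xs \<Longrightarrow> T [s] \<otimes>\<^bsub>H\<^esub> T xs = scale q (T (s # xs)) + scale (q - 1) (T xs)"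
proof -
  have gens: "cls [s] \<in> affA_gens n" "cls xs \<in> carrier (affA n)"
    using assms by (auto simp: affA_gens_def affA_gen_def carrier_affA)
  have mult: "cls [s] \<otimes>\<^bsub>affA n\<^esub> cls xs = cls (s # xs)"
    using assms coxeter_group_mult[of "[s]" S xs "affA_matrix n"] by (simp add: affA_def)
  have descent: "cls [s] \<in> left_descents n (cls xs) \<longleftrightarrow> len (s # xs) < len xs"
    using gens by (simp add: left_descents_def mult word_length_def)
  have closed: "T xs \<in> carrier H" "T (s # xs) \<in> carrier H" using assms by (simp_all add: T_closed)
  have rules: "cls [s] \<notin> left_descents n (cls xs) \<longrightarrow> T [s] \<otimes>\<^bsub>H\<^esub> T xs = T (s # xs)"
    "cls [s] \<in> left_descents n (cls xs) \<longrightarrow>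
      T [s] \<otimes>\<^bsub>H\<^esub> T xs = q \<odot>\<^bsub>H\<^esub> T (s # xs) \<oplus>\<^bsub>H\<^esub> (q - 1) \<odot>\<^bsub>H\<^esub> T xs"
    using hecke gens mult by (auto simp: is_affine_hecke_def T_def)
  show "len xs < len (s # xs) \<Longrightarrow> T [s] \<otimes>\<^bsub>H\<^esub> T xs = T (s # xs)"
    using rules(1) descent by simp
  show "len (s # xs) < len xs \<Longrightarrow> T [s] \<otimes>\<^bsub>H\<^esub> T xs = scale q (T (s # xs)) + scale (q - 1) (T xs)"
    using rules(2) descent closed by (simp add: smult_eq add_eq scale_closed)
qed

lemma mult_of_perm_less:
  assumes "s \<in> S" "xs \<in> lists S" "affine_perm n xs (int s) < affine_perm n xs (int s + 1)"
  shows "T [s] \<otimes>\<^bsub>H\<^esub> T xs = T (s # xs)"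
  using assms n by (intro mult_rule(1) word_length_Cons_of_affine_perm_less) auto

lemma T_quadratic:
  assumes "s \<in> S"
  shows "T [s] \<otimes>\<^bsub>H\<^esub> T [s] = scale q (T []) + scale (q - 1) (T [s])"
    and "T [s] \<otimes>\<^bsub>H\<^esub> T [] = T [s]"
proof -
  have "len [] = 0" using word_length_le[of S "affA_matrix n" "[]" "[]"] by (simp add: cox_eq.cox_refl)
  moreover have "len [s] \<noteq> len []" using assms by (intro len_Cons_neq) auto
  moreover have "eq [s, s] []" using cancel_Cons[OF assms, of "[]"] by simp
  ultimately show "T [s] \<otimes>\<^bsub>H\<^esub> T [s] = scale q (T []) + scale (q - 1) (T [s])"
    and "T [s] \<otimes>\<^bsub>H\<^esub> T [] = T [s]"
    using mult_rule(2)[OF assms, of "[s]"] mult_rule(1)[OF assms, of "[]"] assms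
      word_length_cong[of S "affA_matrix n" "[s, s]" "[]"] T_cong[of "[s, s]" "[]"]
    by auto
qed

text \<open>The multiplication rules prescribe only left multiplication of basis elements by
  generators, so the unit has to be identified. The two bracketings of the product of
  \<open>T [s]\<close>, \<open>T [s]\<close> and \<open>T []\<close>, after cancelling the
  invertible \<open>q\<close>, show that \<open>T []\<close> is idempotent. Induction along reduced
  words then makes it a right identity.\<close>

lemma T_Nil: "T [] = \<one>\<^bsub>H\<^esub>"
proof -
  obtain p where p: "p * q = 1" using q_unit by (metis dvdE mult.commute)
  obtain s where s: "s \<in> S" by (auto simp: affA_index_def)
  have closed: "T [] \<in> carrier H" "T [s] \<in> carrier H" using s by (simp_all add: T_closed)
  have "scale q (T [] \<otimes>\<^bsub>H\<^esub> T []) + scale (q - 1) (T [s]) = (T [s] \<otimes>\<^bsub>H\<^esub> T [s]) \<otimes>\<^bsub>H\<^esub> T []"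
    using closed by (simp add: T_quadratic[OF s] add_mult scale_mult scale_closed)
  also have "\<dots> = T [s] \<otimes>\<^bsub>H\<^esub> (T [s] \<otimes>\<^bsub>H\<^esub> T [])"
    using closed by (intro m_assoc)
  also have "\<dots> = scale q (T []) + scale (q - 1) (T [s])"
    by (simp only: T_quadratic[OF s])
  finally have "scale p (scale q (T [] \<otimes>\<^bsub>H\<^esub> T [])) = scale p (scale q (T []))" by simp
  then have idem: "T [] \<otimes>\<^bsub>H\<^esub> T [] = T []" by (simp add: scale_scale p scale_one)
  have right_T: "T xs \<otimes>\<^bsub>H\<^esub> T [] = T xs" if "xs \<in> lists S" for xs
    using that
  proof (induction "len xs" arbitrary: xs rule: less_induct)
    case less
    obtain ys where ys: "eq xs ys" "length ys = len xs" using reduced_word_exists[OF less.prems] .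
    show ?case
    proof (cases ys)
      case Nil
      then show ?thesis using idem T_cong[OF ys(1)] by simp
    next
      case (Cons t zs)
      have t: "t \<in> S" "zs \<in> lists S" using cox_eq_in_lists[OF ys(1)] Cons by auto
      have "len zs \<le> length zs" by (intro word_length_le cox_eq.cox_refl t(2))
      then have "len zs < len (t # zs)" "len zs < len xs"
        using word_length_cong[OF ys(1)] ys(2) Cons by simp_all
      then have "T xs = T [t] \<otimes>\<^bsub>H\<^esub> T zs" "T zs \<otimes>\<^bsub>H\<^esub> T [] = T zs"
        using T_cong[OF ys(1)] mult_rule(1)[OF t] less.hyps t Cons by simp_all
      then show ?thesis using t closed(1) by (simp add: m_assoc T_closed)
    qed
  qed
  have right: "x \<otimes>\<^bsub>H\<^esub> T [] = x" if "x \<in> carrier H" for x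
    using that unfolding carrier_eq
  proof (induction rule: free_module_induct)
    case zero
    then show ?case using l_null[OF closed(1)] by (simp add: zero_eq)
  next
    case (add x c w)
    then obtain xs where "xs \<in> lists S" "basis_elt w = T xs" by (auto simp: carrier_affA T_def)
    then show ?case
      using add closed(1) right_T[of xs] T_closed[of xs]
      by (simp add: carrier_eq[symmetric] add_mult scale_mult scale_closed)
  qed
  show ?thesis using right[of "\<one>\<^bsub>H\<^esub>"] closed(1) by simp
qed

lemma T_generator_unit:
  assumes "s \<in> S"
  shows "T [s] \<in> Units H"
proof -
  obtain p where p: "p * q = 1" using q_unit by (metis dvdE mult.commute)
  have closed: "T [] \<in> carrier H" "T [s] \<in> carrier H" using assms by (simp_all add: T_closed)
  \<comment> \<open>With \<open>p\<close> the inverse of \<open>q\<close>, this is the quadratic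
    relation solved for the inverse of \<open>T [s]\<close>.\<close>
  define h where "h = scale p (T [s] + scale (1 - q) (T []))"
  have h: "h \<in> carrier H" using closed by (simp add: h_def scale_closed add_closed)
  have one: "T [s] \<otimes>\<^bsub>H\<^esub> T [] = T [s]" "T [] \<otimes>\<^bsub>H\<^esub> T [s] = T [s]"
    using closed by (simp_all add: T_Nil)
  have "T [s] \<otimes>\<^bsub>H\<^esub> T [s] + scale (1 - q) (T [s]) = scale q (T []) + scale ((q - 1) + (1 - q)) (T [s])"
    by (simp only: T_quadratic[OF assms] add.assoc scale_add_left)
  also have "\<dots> = scale q (T [])"
    by (rule poly_mapping_eqI) (simp add: lookup_add lookup_scale)
  finally have "scale p (T [s] \<otimes>\<^bsub>H\<^esub> T [s] + scale (1 - q) (T [s])) = T []"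
    by (simp add: scale_scale p scale_one)
  then have "T [s] \<otimes>\<^bsub>H\<^esub> h = \<one>\<^bsub>H\<^esub>" "h \<otimes>\<^bsub>H\<^esub> T [s] = \<one>\<^bsub>H\<^esub>"
    using closed by (simp_all add: h_def add_mult scale_mult scale_closed add_closed one flip: T_Nil)
  then show ?thesis using closed(2) h by (auto simp: Units_def)
qed

text \<open>Here \<open>s\<close> is a left descent, so \<open>s # xs\<close> expresses the shorter
  element and \<open>T xs\<close> has \<open>T [s]\<close> as a left factor, which the inverse
  strips off.\<close>

lemma inv_mult_of_perm_greater:
  assumes "s \<in> S" "xs \<in> lists S" "affine_perm n xs (int s + 1) < affine_perm n xs (int s)"
  shows "inv\<^bsub>H\<^esub> (T [s]) \<otimes>\<^bsub>H\<^esub> T xs = T (s # xs)"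
proof -
  have "2 \<le> int n + 1" using n by simp
  then have "affine_perm n (s # xs) (int s) < affine_perm n (s # xs) (int s + 1)"
    using assms(3) by (simp add: affine_swap_left affine_swap_right)
  then have "T [s] \<otimes>\<^bsub>H\<^esub> T (s # xs) = T (s # s # xs)"
    using assms by (intro mult_of_perm_less) auto
  then have "T xs = T [s] \<otimes>\<^bsub>H\<^esub> T (s # xs)"
    using T_cong[OF cancel_Cons[OF assms(1,2)]] by simp
  then show ?thesis
    using assms T_generator_unit[OF assms(1)] by (simp add: T_closed flip: m_assoc)
qed

end

section \<open>The arrow between consecutive algebras and its injectivity\<close>

locale hecke_arrow = source: affine_hecke k q E + target: affine_hecke n q H
  for n k :: nat and q :: "'k::{comm_ring, comm_monoid_mult}" and E H +
  fixes f
  assumes pred_n: "n - 1 = k" and arrow: "is_HR n E H f"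
begin

lemma n_eq: "n = Suc k" and n_ge_2: "2 \<le> n"
  using pred_n source.n by auto

lemmas embed_word_in_lists' = embed_word_in_lists[OF n_ge_2, unfolded pred_n]
lemmas affine_perm_embed_word' = affine_perm_embed_word[OF n_ge_2, unfolded pred_n]

lemma f_hom: "f \<in> ring_hom E H"
  and f_smult: "x \<in> carrier E \<Longrightarrow> f (scale c x) = scale c (f x)"
proof -
  show hom: "f \<in> ring_hom E H" using arrow by (simp add: is_HR_def algebra_hom_def)
  assume x: "x \<in> carrier E"
  then have "f (c \<odot>\<^bsub>E\<^esub> x) = c \<odot>\<^bsub>H\<^esub> f x" using arrow by (auto simp: is_HR_def algebra_hom_def)
  then show "f (scale c x) = scale c (f x)"
    using x ring_hom_closed[OF hom x] by (simp add: source.smult_eq target.smult_eq)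
qed

lemma f_gen: "1 \<le> i \<Longrightarrow> i \<le> k \<Longrightarrow> f (source.T [i]) = target.T [i]"
  and f_gen_last: "f (source.T [n]) =
    target.T [n] \<otimes>\<^bsub>H\<^esub> target.T [n + 1] \<otimes>\<^bsub>H\<^esub> inv\<^bsub>H\<^esub> target.T [n]"
  using arrow unfolding is_HR_def pred_n source.T_def target.T_def affA_gen_def by simp_all

text \<open>
  On the right of \<open>shift_power n l\<close>, the values at the multiples of \<open>n + 1\<close> are smaller than
  all values that a word of length at most \<open>l\<close> can compare them with. Hence the factor
  \<open>g_{\<sigma>_n}^{-1}\<close> always shortens and the other two factors always lengthen.
\<close>

lemma f_mult_shift_power:
  assumes "xs \<in> lists (affA_index k)" "source.len xs = length xs" "length xs \<le> l" "1 \<le> l"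
  shows "f (source.T xs) \<otimes>\<^bsub>H\<^esub> target.T (shift_power n l) = target.T (embed_word n xs @ shift_power n l)"
  using assms
proof (induction xs rule: list.induct)
  case Nil
  have "f (source.T []) = \<one>\<^bsub>H\<^esub>"
    using ring_hom_one[OF f_hom] by (simp add: source.T_Nil)
  then show ?case
    by (simp add: embed_word_def target.T_closed shift_power_in_lists)
next
  case (Cons i xs)
  have i: "i \<in> affA_index k" "1 \<le> i" "i \<le> n" and xs: "xs \<in> lists (affA_index k)"
    using Cons.prems(1) n_eq by (auto simp: affA_index_def)
  have "source.len xs \<le> length xs" by (intro word_length_le cox_eq.cox_refl xs)
  moreover have "source.len (i # xs) \<le> Suc (source.len xs)"
    using word_length_append_le[of "[i]" _ xs] i(1) xs by fastforce
  ultimately have len: "source.len xs = length xs" "source.len xs < source.len (i # xs)"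
    using Cons.prems(2) by simp_all
  define v where "v = embed_word n xs @ shift_power n l"
  have v: "v \<in> lists target.S"
    using embed_word_in_lists'[OF xs] shift_power_in_lists by (simp add: v_def)
  have IH: "f (source.T xs) \<otimes>\<^bsub>H\<^esub> target.T (shift_power n l) = target.T v"
    using Cons.IH xs len(1) Cons.prems(3,4) by (simp add: v_def)
  have "source.T (i # xs) = source.T [i] \<otimes>\<^bsub>E\<^esub> source.T xs"
    using source.mult_rule(1)[OF i(1) xs len(2)] by simp
  then have split: "f (source.T (i # xs)) \<otimes>\<^bsub>H\<^esub> target.T (shift_power n l) = f (source.T [i]) \<otimes>\<^bsub>H\<^esub> target.T v"
    using i(1) xs ring_hom_mult[OF f_hom] ring_hom_closed[OF f_hom]
    by (simp add: source.T_closed target.T_closed shift_power_in_lists target.m_assoc IH)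
  have up: "affine_perm k xs (int i) < affine_perm k xs (int i + 1)"
    using source.n i(1) xs len(2) by (intro affine_perm_less_of_word_length)
  have perm_v: "affine_perm n v (skip n j) = skip n (affine_perm k xs j + int l)"
    "affine_perm n v ((int n + 1) * a) = (int n + 1) * (a - int l)" for j a
    using affine_perm_embed_word'[OF xs] affine_perm_shift_power[OF n_ge_2]
    by (simp_all add: v_def affine_perm_append)
  then have less_v: "affine_perm n v (skip n (int i)) < affine_perm n v (skip n (int i + 1))"
    using up strict_mono_skip[of n] by (simp add: strict_mono_less)
  have "f (source.T [i]) \<otimes>\<^bsub>H\<^esub> target.T v = target.T (embed_gen n i @ v)"
  proof (cases "i < n")
    case True
    then have "affine_perm n v (int i) < affine_perm n v (int i + 1)"
      using less_v i(2) by (simp add: skip_base)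
    then show ?thesis
      using target.mult_of_perm_less[of i v] True i(2) v f_gen n_eq by (simp add: embed_gen_def affA_index_def)
  next
    case False
    then have in_eq: "i = n" using i(3) by simp
    have S: "n \<in> target.S" "n + 1 \<in> target.S" using n_ge_2 by (simp_all add: affA_index_def)
    have N: "2 \<le> int n + 1" "3 \<le> int n + 1" using n_ge_2 by simp_all
    \<comment> \<open>The letter \<open>i\<close> also counts towards \<open>l\<close>, so
      \<open>xs\<close> lowers \<open>n\<close> by at most \<open>l - 1\<close>. Hence
      \<open>v\<close> takes \<open>n\<close> to at least \<open>n + 2\<close>, while it takes
      \<open>n + 1\<close> to a multiple of \<open>n + 1\<close> that is at most 0 because
      \<open>1 \<le> l\<close>.\<close>
    have "int n + 1 \<le> affine_perm k xs (int n) + int l"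
      using abs_affine_perm_diff_le[of k xs "int n"] Cons.prems(3) by simp
    then have "skip n (int n + 1) \<le> skip n (affine_perm k xs (int n) + int l)"
      using strict_mono_skip[of n] by (simp add: strict_mono_less_eq)
    moreover have skip: "skip n (int n) = int n" "skip n (int n + 1) = int n + 2"
      using n_ge_2 by (simp_all add: skip_def)
    moreover have "(int n + 1) * (1 - int l) \<le> 0"
      using Cons.prems(4) by (simp add: mult_nonneg_nonpos)
    ultimately have less1: "affine_perm n v (int n + 1) < affine_perm n v (int n)"
      using perm_v(1)[of "int n"] perm_v(2)[of 1] by simp
    \<comment> \<open>In the enumeration \<open>skip\<close> the successor of \<open>n\<close> is
      \<open>n + 2\<close>, so this is the ascent of \<open>xs\<close> at the index of
      \<open>a_n\<close>.\<close>
    have less2: "affine_perm n v (int n) < affine_perm n v (int n + 2)"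
      using less_v skip in_eq by simp
    have dvd: "int n + 1 dvd int n - int n" by simp
    note swap = affine_swap_left[OF dvd] affine_swap_right[OF N(1) dvd] affine_swap_adjacent[OF N(2) dvd]
    have perm: "affine_perm n (n # v) (int n) = affine_perm n v (int n + 1)"
      "affine_perm n (n # v) (int n + 1) = affine_perm n v (int n)"
      "affine_perm n (n # v) (int n + 2) = affine_perm n v (int n + 2)"
      by (simp_all only: affine_perm.simps swap)
    have int_Suc: "int (n + 1) = int n + 1" "int n + 1 + 1 = int n + 2" by simp_all
    have perm': "affine_perm n ((n + 1) # n # v) (int n) = affine_perm n v (int n + 1)"
      "affine_perm n ((n + 1) # n # v) (int n + 1) = affine_perm n v (int n + 2)"
      by (simp_all only: affine_perm.simps(2)[of n "n + 1"] int_Suc swap perm)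
    \<comment> \<open>The three factors of the image of \<open>a_n\<close> are applied from the
      right. The inverse meets a descent; the other two meet ascents, which come down to comparing
      the values of \<open>v\<close> at \<open>n\<close> and \<open>n + 2\<close>, then at
      \<open>n + 1\<close> and \<open>n + 2\<close>.\<close>
    let ?g = "target.T [n]" and ?a = "target.T [n + 1]"
    have 1: "inv\<^bsub>H\<^esub> ?g \<otimes>\<^bsub>H\<^esub> target.T v = target.T (n # v)"
      using S v less1 by (intro target.inv_mult_of_perm_greater) auto
    have 2: "?a \<otimes>\<^bsub>H\<^esub> target.T (n # v) = target.T ((n + 1) # n # v)"
      using S v less2 by (intro target.mult_of_perm_less) (simp_all only: int_Suc perm lists.Cons)
    have 3: "?g \<otimes>\<^bsub>H\<^esub> target.T ((n + 1) # n # v) = target.T (n # (n + 1) # n # v)"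
      using S v less_trans[OF less1 less2]
      by (intro target.mult_of_perm_less) (simp_all only: perm' lists.Cons)
    have closed: "?g \<in> carrier H" "?a \<in> carrier H" "inv\<^bsub>H\<^esub> ?g \<in> carrier H" "target.T v \<in> carrier H"
      using S v target.T_generator_unit[OF S(1)] by (auto simp: target.T_closed)
    then have "f (source.T [i]) \<otimes>\<^bsub>H\<^esub> target.T v = ?g \<otimes>\<^bsub>H\<^esub> (?a \<otimes>\<^bsub>H\<^esub> (inv\<^bsub>H\<^esub> ?g \<otimes>\<^bsub>H\<^esub> target.T v))"
      by (simp only: in_eq f_gen_last target.m_assoc target.m_closed)
    then show ?thesis by (simp only: 1 2 3 in_eq) (simp add: embed_gen_def)
  qed
  then show ?case by (simp add: split embed_word_Cons v_def)
qed

text \<open>On the image of \<open>skip\<close> both words act like the source words followed by a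
  shift by \<open>l\<close> places. Cancelling the shift and \<open>skip\<close> leaves equal affine
  permutations of the smaller period, and these determine the element.\<close>

lemma cls_embed_word_inj:
  assumes "xs \<in> lists (affA_index k)" "ys \<in> lists (affA_index k)"
    and "target.cls (embed_word n xs @ shift_power n l) = target.cls (embed_word n ys @ shift_power n l)"
  shows "source.cls xs = source.cls ys"
proof -
  have "target.eq (embed_word n xs @ shift_power n l) (embed_word n ys @ shift_power n l)"
    using assms embed_word_in_lists'[OF assms(1)] shift_power_in_lists by (simp add: cox_class_eq_iff)
  from affine_perm_cong[OF this target.n]
  have "affine_perm n (embed_word n xs @ shift_power n l) (skip n j)
      = affine_perm n (embed_word n ys @ shift_power n l) (skip n j)" for j
    by simp
  then have "skip n (affine_perm k xs j + int l) = skip n (affine_perm k ys j + int l)" for j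
    using affine_perm_embed_word' affine_perm_shift_power[OF n_ge_2] assms(1,2)
    by (simp add: affine_perm_append)
  then have "affine_perm k xs = affine_perm k ys"
    using strict_mono_eq[OF strict_mono_skip[of n]] by (intro ext) simp
  then show ?thesis
    using affine_perm_faithful[OF source.n assms(1,2)] assms(1) by (simp add: cox_class_eq_iff)
qed

lemma f_inj: "inj_on f (carrier E)"
proof (rule inj_onI)
  fix x y
  assume xy: "x \<in> carrier E" "y \<in> carrier E" "f x = f y"
  \<comment> \<open>One \<open>l\<close> bounds the lengths in both supports, so the same right
    factor serves \<open>x\<close> and \<open>y\<close>. The \<open>Suc\<close> supplies the
    \<open>1 \<le> l\<close> that \<open>f_mult_shift_power\<close> asks for, and
    \<open>insert 0\<close> covers empty supports.\<close>
  define l where "l = Suc (Max (insert 0 (cox_length ` (Poly_Mapping.keys x \<union> Poly_Mapping.keys y))))"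
  define W where "W = {w \<in> carrier (affA k). cox_length w \<le> l}"
  have "cox_length w \<le> l" if "w \<in> Poly_Mapping.keys x \<union> Poly_Mapping.keys y" for w
    unfolding l_def using that by (intro le_SucI Max_ge) auto
  then have W: "x \<in> free_module W" "y \<in> free_module W" "free_module W \<subseteq> carrier E"
    using xy(1,2) by (auto simp: W_def source.carrier_eq free_module_def)
  have "\<exists>xs. xs \<in> lists (affA_index k) \<and> w = source.cls xs \<and> source.len xs = length xs \<and> length xs \<le> l"
    if w: "w \<in> W" for w
  proof -
    obtain xs where xs: "xs \<in> lists (affA_index k)" "w = source.cls xs"
      using w by (auto simp: W_def source.carrier_affA)
    obtain ys where "source.eq xs ys" "length ys = source.len xs" using reduced_word_exists[OF xs(1)] .
    then show ?thesis
      using w xs cox_eq_in_lists[of _ _ xs ys] word_length_cong[of _ _ xs ys]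
        cox_class_eq_iff[OF xs(1), of _ ys]
      by (intro exI[of _ ys]) (auto simp: W_def word_length_def)
  qed
  \<comment> \<open>A choice of a reduced word for each element of \<open>W\<close>, since
    \<open>f_mult_shift_power\<close> is stated for reduced words.\<close>
  then obtain r where r: "\<And>w. w \<in> W \<Longrightarrow> r w \<in> lists (affA_index k) \<and> w = source.cls (r w)
      \<and> source.len (r w) = length (r w) \<and> length (r w) \<le> l"
    by metis
  define \<psi> where "\<psi> w = target.cls (embed_word n (r w) @ shift_power n l)" for w
  \<comment> \<open>Right multiplication turns \<open>f\<close> into a linear map that sends the
    basis element of \<open>w\<close> to that of \<open>\<psi> w\<close>, for \<open>w\<close> in
    \<open>W\<close>. Equality of \<open>f x\<close> and \<open>f y\<close> passes on to
    \<open>\<Phi>\<close>.\<close>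
  define \<Phi> where "\<Phi> x = f x \<otimes>\<^bsub>H\<^esub> target.T (shift_power n l)" for x
  have T: "target.T (shift_power n l) \<in> carrier H"
    by (simp add: target.T_closed shift_power_in_lists)
  have "inj_on \<psi> W"
    using r cls_embed_word_inj by (intro inj_onI) (metis \<psi>_def)
  moreover have "\<Phi> 0 = 0"
    using ring_hom_zero[OF f_hom source.ring_axioms target.ring_axioms] target.l_null[OF T]
    by (simp add: \<Phi>_def source.zero_eq target.zero_eq)
  moreover have "\<Phi> (u + v) = \<Phi> u + \<Phi> v" if "u \<in> free_module W" "v \<in> free_module W" for u v
  proof -
    have "u \<in> carrier E" "v \<in> carrier E" using that W(3) by auto
    then show ?thesis
      using ring_hom_add[OF f_hom, of u v] ring_hom_closed[OF f_hom] T
      by (simp add: \<Phi>_def source.add_eq target.add_eq target.add_mult)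
  qed
  moreover have "\<Phi> (scale c u) = scale c (\<Phi> u)" if "u \<in> free_module W" for c u
  proof -
    have "u \<in> carrier E" using that W(3) by auto
    then show ?thesis
      using ring_hom_closed[OF f_hom] T by (simp add: \<Phi>_def f_smult target.scale_mult)
  qed
  moreover have "\<Phi> (basis_elt w) = basis_elt (\<psi> w)" if "w \<in> W" for w
  proof -
    have "basis_elt w = source.T (r w)" using r[OF that] by (simp add: source.T_def)
    then show ?thesis
      using f_mult_shift_power[of "r w" l] r[OF that]
      by (simp add: \<Phi>_def \<psi>_def l_def flip: target.T_def)
  qed
  ultimately have lookup: "Poly_Mapping.lookup (\<Phi> z) (\<psi> w) = Poly_Mapping.lookup z w"
    if "z \<in> free_module W" "w \<in> W" for z w
    using lookup_of_basis_injection[of z W \<psi> \<Phi> w] that by blast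
  show "x = y"
  proof (rule poly_mapping_eqI)
    fix w
    show "Poly_Mapping.lookup x w = Poly_Mapping.lookup y w"
    proof (cases "w \<in> W")
      case True
      then show ?thesis using lookup[OF W(1) True] lookup[OF W(2) True] xy(3) by (simp add: \<Phi>_def)
    next
      case False
      then have "w \<notin> Poly_Mapping.keys x" "w \<notin> Poly_Mapping.keys y" using W by (auto simp: free_module_def)
      then show ?thesis by (simp add: in_keys_iff)
    qed
  qed
qed

end

theorem corollary5p8:
  fixes q :: "'k::{comm_ring, comm_monoid_mult}"
    and H :: "nat \<Rightarrow> ('k, nat list set \<Rightarrow>\<^sub>0 'k) module"
    and HR :: "(nat list set \<Rightarrow>\<^sub>0 'k) \<Rightarrow> (nat list set \<Rightarrow>\<^sub>0 'k)"
    and n :: nat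
  assumes "q dvd 1"
    and "n \<ge> 2"
    and "is_affine_hecke (n - 1) q (H (n - 1))"
    and "is_affine_hecke n q (H n)"
    and "is_HR n (H (n - 1)) (H n) HR"
  shows "inj_on HR (carrier (H (n - 1)))"
proof -
  interpret hecke_arrow n "n - 1" q "H (n - 1)" "H n" HR
    using assms by unfold_locales auto
  show ?thesis by (rule f_inj)
qed

end
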